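(* Let $X$ and $Y$ be proper, locally path-connected metric spaces, let $\Omega\subset X$ be an unbounded domain, let $\Omega'\subset Y$ be a domain, and let $f:\Omega\to\Omega'$ be a branched quasisymmetric (BQS) homeomorphism. Then there is a homeomorphism $f_P:\overline\Omega^P\to\overline{\Omega'}^P$ extending $f$ such that, for every prime end $\mathscr E$ of $\Omega$: (1) if $\mathscr E$ is a bounded prime end (type (a)), then $f_P(\mathscr E)$ is a bounded prime end (type (a)) of $\Omega'$; (2) if $\mathscr E$ is an unbounded prime end (type (b)) or an end at $\infty$ (type (c)) of $\Omega$, then $f_P(\mathscr E)$ is either an unbounded prime end (type (b)) or an end at $\infty$ (type (c)) of $\Omega'$. Moreover, if $\mathscr E$ is a singleton prime end, then so is $f_P(\mathscr E)$.
   Context: A metric space is proper if its closed bounded subsets are compact. A domain is a non-empty open connected set. A continuum is a compact connected set; it is nondegenerate if it has at least two points. BQS: a homeomorphism $f:\Omega\to\Omega'$ is BQS if there is a monotone increasing $\eta:(0,\infty)\to(0,\infty)$ with $\lim_{t\to0^+}\eta(t)=0$ such that for all nondegenerate continua $E,F\subset\Omega$ with $E\cap F\neq\emptyset$, $\frac{\operatorname{diam} f(E)}{\operatorname{diam} f(F)}\le\eta\left(\frac{\operatorname{diam}E}{\operatorname{diam}F}\right)$. Mazurkiewicz metric on $\Omega$: $d_M(x,y)=\inf_E\operatorname{diam}(E)$ over continua $E\subset\Omega$ containing $x,y$; $\operatorname{diam}_M$ is diameter with respect to $d_M$. For $A,B\subset\Omega$, $\operatorname{dist}_M(A,B)=\inf_\gamma\operatorname{diam}(\gamma)$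 over continua $\gamma\subset\Omega$ meeting both $A$ and $B$ (infimum of the empty set is $\infty$). Chains. Closures and boundaries are in $X$. A connected set $E\subset\Omega$ is acceptable if $\overline E$ is proper and $\overline E\cap\partial\Omega\neq\emptyset$. A sequence $\{E_k\}$ of acceptable sets is a chain if for each $k$: (a) $E_{k+1}\subset E_k$; (b) $\overline{E_k}$ is compact, or $E_k$ is unbounded and there is a compact set $R_k\subset X$ with $\operatorname{diam}_M(R_k\cap\Omega)<\infty$ such that $\Omega\setminus R_k$ has two (distinct) components $C_{1,k},C_{2,k}$ with $\Omega\cap\partial E_k\subset C_{1,k}$ and $\Omega\cap\partial E_{k+1}\subset C_{2,k}$; (c) $\operatorname{dist}_M(\Omega\cap\partial E_k,\Omega\cap\partial E_{k+1})>0$; (d) $\emptyset\neq\bigcap_k\overline{E_k}\subset\partial\Omega$. Chains at $\infty$. An unbounded connected set $E\subset\Omega$ is acceptable at $\infty$ if $\overline E$ is proper and there is a compact $K\subset X$ with $\operatorname{diam}_M(K\cap\Omega)<\infty$ such that $E$ is a component of $\Omega\setminus K$. A sequence $\{E_k\}$ of such sets is a chain at $\infty$ if for each $k$, $E_{k+1}\subset E_k$ and $\operatorname{dist}_M(\Omega\cap\partial E_k,\Omega\cap\partial E_{k+1})>0$, and $\bigcap_k\overline{E_k}=\emptyset$. Ends. For chains (of either kind), $\{E_k\}$ divides $\{F_k\}$ if for each $k$ there is $i_k$ with $E_{i_k}\subset F_k$; chains are equivalent if they divide each other; an end is an equivalence class $[E_k]$; divisibility passes to ends; a prime end is an end divisible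 only by itself. (Every end at $\infty$ is a prime end.) The impression of an end is $\bigcap_k\overline{E_k}$ for any representing chain; a singleton prime end is one whose impression is a single point. Types: (a) bounded: $\overline{E_k}$ is compact for some $k$; (b) unbounded: each $E_k$ is unbounded and the impression is non-empty; (c) ends at $\infty$: represented by chains at $\infty$. $\partial_P\Omega$ is the set of all prime ends (of all types) and $\overline\Omega^P=\Omega\cup\partial_P\Omega$. The same definitions apply to $\Omega'\subset Y$. Topology of $\overline\Omega^P$: the topology determined by the following sequential convergence (a set is closed iff it contains all limits of sequences in it). Convergence to a point of $\Omega$ is the usual metric convergence (with the tail of the sequence in $\Omega$). A sequence $\{x_j\}\subset\Omega$ converges to a prime end $[E_k]$ if for each $k$ there is $N_k$ with $x_j\in E_k$ for all $j\ge N_k$. A sequence of prime ends $[E_{m,j}]_m$, $j\in\mathbb N$, converges to a prime end $[E_k]$ if for each $k$ there is $N_k$ such that for each $j\ge N_k$ there is $m_{j,k}$ with $E_{m_{j,k},j}\subset E_k$. *)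

theory Defs
  imports "HOL-Analysis.Analysis"
begin

section \<open>Metric notions\<close>

definition proper_set :: "'a::metric_space set \<Rightarrow> bool" where
  "proper_set A \<longleftrightarrow>
     (\<forall>S. closedin (top_of_set A) S \<and> bounded S \<longrightarrow> compact S)"

definition metric_domain :: "'a::metric_space set \<Rightarrow> bool" where
  "metric_domain \<Omega> \<longleftrightarrow> \<Omega> \<noteq> {} \<and> open \<Omega> \<and> connected \<Omega>"

text \<open>The empty set is harmless here: every continuum used below is required to contain or to
  meet something.\<close>

definition continuum :: "'a::metric_space set \<Rightarrow> bool" where
  "continuum E \<longleftrightarrow> compact E \<and> connected E"

definition nondegenerate_continuum :: "'a::metric_space set \<Rightarrow> bool" where
  "nondegenerate_continuum E \<longleftrightarrow> continuum E \<and> (\<exists>x\<in>E. \<exists>y\<in>E. x \<noteq> y)"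

definition BQS_homeomorphism ::
  "'a::metric_space set \<Rightarrow> 'b::metric_space set \<Rightarrow> ('a \<Rightarrow> 'b) \<Rightarrow> bool" where
  "BQS_homeomorphism \<Omega> \<Omega>' f \<longleftrightarrow>
     (\<exists>g. homeomorphism \<Omega> \<Omega>' f g) \<and>
     (\<exists>\<eta>::real \<Rightarrow> real.
        (\<forall>t>0. \<eta> t > 0) \<and> mono_on {0<..} \<eta> \<and> (\<eta> \<longlongrightarrow> 0) (at_right 0) \<and>
        (\<forall>E F. nondegenerate_continuum E \<and> E \<subseteq> \<Omega> \<and>
               nondegenerate_continuum F \<and> F \<subseteq> \<Omega> \<and> E \<inter> F \<noteq> {} \<longrightarrow>
               diameter (f ` E) / diameter (f ` F) \<le> \<eta> (diameter E / diameter F)))"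

text \<open>The Mazurkiewicz quantities are \<^typ>\<open>ennreal\<close>-valued: an infimum over no continua is
  \<open>\<infinity>\<close>, and the diameter of the empty set is \<open>0\<close>.  The real-valued \<^const>\<open>diameter\<close> is only
  applied to compact sets.\<close>

definition mazurkiewicz_dist :: "'a::metric_space set \<Rightarrow> 'a \<Rightarrow> 'a \<Rightarrow> ennreal" where
  "mazurkiewicz_dist \<Omega> x y =
     (INF E\<in>{E. continuum E \<and> E \<subseteq> \<Omega> \<and> x \<in> E \<and> y \<in> E}. ennreal (diameter E))"

definition mazurkiewicz_diam :: "'a::metric_space set \<Rightarrow> 'a set \<Rightarrow> ennreal" where
  "mazurkiewicz_diam \<Omega> A = (SUP x\<in>A. SUP y\<in>A. mazurkiewicz_dist \<Omega> x y)"

definition mazurkiewicz_setdist :: "'a::metric_space set \<Rightarrow> 'a set \<Rightarrow> 'a set \<Rightarrow> ennreal" where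
  "mazurkiewicz_setdist \<Omega> A B =
     (INF C\<in>{C. continuum C \<and> C \<subseteq> \<Omega> \<and> C \<inter> A \<noteq> {} \<and> C \<inter> B \<noteq> {}}. ennreal (diameter C))"

section \<open>Chains\<close>

definition acceptable :: "'a::metric_space set \<Rightarrow> 'a set \<Rightarrow> bool" where
  "acceptable \<Omega> E \<longleftrightarrow>
     connected E \<and> E \<subseteq> \<Omega> \<and> proper_set (closure E) \<and> closure E \<inter> frontier \<Omega> \<noteq> {}"

definition end_chain :: "'a::metric_space set \<Rightarrow> (nat \<Rightarrow> 'a set) \<Rightarrow> bool" where
  "end_chain \<Omega> E \<longleftrightarrow>
     (\<forall>k. acceptable \<Omega> (E k)) \<and>
     (\<forall>k. E (Suc k) \<subseteq> E k) \<and>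
     (\<forall>k. compact (closure (E k)) \<or>
          (\<not> bounded (E k) \<and>
           (\<exists>R. compact R \<and> mazurkiewicz_diam \<Omega> (R \<inter> \<Omega>) < \<infinity> \<and>
                (\<exists>C1\<in>components (\<Omega> - R). \<exists>C2\<in>components (\<Omega> - R).
                   C1 \<noteq> C2 \<and>
                   \<Omega> \<inter> frontier (E k) \<subseteq> C1 \<and> \<Omega> \<inter> frontier (E (Suc k)) \<subseteq> C2)))) \<and>
     (\<forall>k. mazurkiewicz_setdist \<Omega> (\<Omega> \<inter> frontier (E k)) (\<Omega> \<inter> frontier (E (Suc k))) > 0) \<and>
     (\<Inter>k. closure (E k)) \<noteq> {} \<and> (\<Inter>k. closure (E k)) \<subseteq> frontier \<Omega>"

definition acceptable_at_infinity :: "'a::metric_space set \<Rightarrow> 'a set \<Rightarrow> bool" where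
  "acceptable_at_infinity \<Omega> E \<longleftrightarrow>
     \<not> bounded E \<and> connected E \<and> E \<subseteq> \<Omega> \<and> proper_set (closure E) \<and>
     (\<exists>K. compact K \<and> mazurkiewicz_diam \<Omega> (K \<inter> \<Omega>) < \<infinity> \<and> E \<in> components (\<Omega> - K))"

definition end_chain_at_infinity :: "'a::metric_space set \<Rightarrow> (nat \<Rightarrow> 'a set) \<Rightarrow> bool" where
  "end_chain_at_infinity \<Omega> E \<longleftrightarrow>
     (\<forall>k. acceptable_at_infinity \<Omega> (E k)) \<and>
     (\<forall>k. E (Suc k) \<subseteq> E k) \<and>
     (\<forall>k. mazurkiewicz_setdist \<Omega> (\<Omega> \<inter> frontier (E k)) (\<Omega> \<inter> frontier (E (Suc k))) > 0) \<and>
     (\<Inter>k. closure (E k)) = {}"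

section \<open>Ends\<close>

definition all_end_chains :: "'a::metric_space set \<Rightarrow> (nat \<Rightarrow> 'a set) set" where
  "all_end_chains \<Omega> = {E. end_chain \<Omega> E \<or> end_chain_at_infinity \<Omega> E}"

definition chain_divides :: "(nat \<Rightarrow> 'a set) \<Rightarrow> (nat \<Rightarrow> 'a set) \<Rightarrow> bool" where
  "chain_divides E F \<longleftrightarrow> (\<forall>k. \<exists>i. E i \<subseteq> F k)"

definition chain_equiv ::
  "'a::metric_space set \<Rightarrow> ((nat \<Rightarrow> 'a set) \<times> (nat \<Rightarrow> 'a set)) set" where
  "chain_equiv \<Omega> =
     {(E, F). E \<in> all_end_chains \<Omega> \<and> F \<in> all_end_chains \<Omega> \<and>
              chain_divides E F \<and> chain_divides F E}"

definition ends :: "'a::metric_space set \<Rightarrow> (nat \<Rightarrow> 'a set) set set" where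
  "ends \<Omega> = all_end_chains \<Omega> // chain_equiv \<Omega>"

lemma chain_divides_trans:
  "chain_divides E F \<Longrightarrow> chain_divides F G \<Longrightarrow> chain_divides E G"
  unfolding chain_divides_def by (meson subset_trans)

lemma equiv_chain_equiv: "equiv (all_end_chains \<Omega>) (chain_equiv \<Omega>)"
proof (rule equivI)
  show "trans (chain_equiv \<Omega>)"
    unfolding trans_def chain_equiv_def by (auto intro: chain_divides_trans)
qed (auto simp: chain_equiv_def refl_on_def sym_def chain_divides_def)

definition end_divides :: "(nat \<Rightarrow> 'a set) set \<Rightarrow> (nat \<Rightarrow> 'a set) set \<Rightarrow> bool" where
  "end_divides \<E> \<F> \<longleftrightarrow> (\<exists>E\<in>\<E>. \<exists>F\<in>\<F>. chain_divides E F)"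

definition prime_ends :: "'a::metric_space set \<Rightarrow> (nat \<Rightarrow> 'a set) set set" where
  "prime_ends \<Omega> = {\<E> \<in> ends \<Omega>. \<forall>\<F>\<in>ends \<Omega>. end_divides \<F> \<E> \<longrightarrow> \<F> = \<E>}"

text \<open>All representing chains have the same intersection of closures
  (lemma \<open>impression_eq\<close>), so intersecting over all of them involves no choice.\<close>

definition impression :: "(nat \<Rightarrow> 'a::metric_space set) set \<Rightarrow> 'a set" where
  "impression \<E> = (\<Inter>E\<in>\<E>. \<Inter>k. closure (E k))"

lemma impression_eq:
  assumes "\<E> \<in> ends \<Omega>" "E \<in> \<E>"
  shows "impression \<E> = (\<Inter>k. closure (E k))"
proof -
  have "(\<Inter>k. closure (E k)) \<subseteq> closure (F k)" if "F \<in> \<E>" for F k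
  proof -
    have "(E, F) \<in> chain_equiv \<Omega>"
      using quotient_eq_iff[OF equiv_chain_equiv, of \<E> \<Omega> \<E> E F] assms that
      by (simp add: ends_def)
    then obtain i where "E i \<subseteq> F k"
      unfolding chain_equiv_def chain_divides_def by blast
    then show ?thesis using closure_mono by blast
  qed
  then show ?thesis using assms(2) by (auto simp: impression_def)
qed

definition singleton_prime_ends :: "'a::metric_space set \<Rightarrow> (nat \<Rightarrow> 'a set) set set" where
  "singleton_prime_ends \<Omega> = {\<E> \<in> prime_ends \<Omega>. \<exists>x. impression \<E> = {x}}"

definition bounded_prime_ends :: "'a::metric_space set \<Rightarrow> (nat \<Rightarrow> 'a set) set set" where
  "bounded_prime_ends \<Omega> = {\<E> \<in> prime_ends \<Omega>. \<exists>E\<in>\<E>. \<exists>k. compact (closure (E k))}"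

definition unbounded_prime_ends :: "'a::metric_space set \<Rightarrow> (nat \<Rightarrow> 'a set) set set" where
  "unbounded_prime_ends \<Omega> =
     {\<E> \<in> prime_ends \<Omega>. (\<exists>E\<in>\<E>. \<forall>k. \<not> bounded (E k)) \<and> impression \<E> \<noteq> {}}"

definition ends_at_infinity :: "'a::metric_space set \<Rightarrow> (nat \<Rightarrow> 'a set) set set" where
  "ends_at_infinity \<Omega> = {\<E> \<in> ends \<Omega>. \<exists>E\<in>\<E>. end_chain_at_infinity \<Omega> E}"

section \<open>The prime end closure\<close>

text \<open>Points of the domain are tagged with \<^const>\<open>Inl\<close>, prime ends with \<^const>\<open>Inr\<close>.\<close>

type_synonym 'a prime_end_point = "'a + (nat \<Rightarrow> 'a set) set"

definition prime_end_closure :: "'a::metric_space set \<Rightarrow> 'a prime_end_point set" where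
  "prime_end_closure \<Omega> = Inl ` \<Omega> \<union> Inr ` prime_ends \<Omega>"

text \<open>A sequence mixing points and prime ends is given no limit at a prime end.  This does not
  affect the topology: such a sequence has a subsequence of one kind, and the topology only sees
  which sets contain the limits of their sequences.\<close>

inductive prime_end_converges ::
  "'a::metric_space set \<Rightarrow> (nat \<Rightarrow> 'a prime_end_point) \<Rightarrow> 'a prime_end_point \<Rightarrow> bool"
  for \<Omega> :: "'a set" where
  to_point:
    "x \<in> \<Omega> \<Longrightarrow> \<forall>j\<ge>N. s j = Inl (u j) \<and> u j \<in> \<Omega> \<Longrightarrow> u \<longlonglongrightarrow> x
     \<Longrightarrow> prime_end_converges \<Omega> s (Inl x)"
| points_to_end:
    "\<E> \<in> prime_ends \<Omega> \<Longrightarrow> E \<in> \<E>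
     \<Longrightarrow> \<forall>j. s j = Inl (u j) \<and> u j \<in> \<Omega>
     \<Longrightarrow> \<forall>k. \<exists>N. \<forall>j\<ge>N. u j \<in> E k
     \<Longrightarrow> prime_end_converges \<Omega> s (Inr \<E>)"
| ends_to_end:
    "\<E> \<in> prime_ends \<Omega> \<Longrightarrow> E \<in> \<E>
     \<Longrightarrow> \<forall>j. s j = Inr (\<F> j) \<and> \<F> j \<in> prime_ends \<Omega> \<and> F j \<in> \<F> j
     \<Longrightarrow> \<forall>k. \<exists>N. \<forall>j\<ge>N. \<exists>m. F j m \<subseteq> E k
     \<Longrightarrow> prime_end_converges \<Omega> s (Inr \<E>)"

definition prime_end_closed :: "'a::metric_space set \<Rightarrow> 'a prime_end_point set \<Rightarrow> bool" where
  "prime_end_closed \<Omega> C \<longleftrightarrow>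
     C \<subseteq> prime_end_closure \<Omega> \<and>
     (\<forall>s l. range s \<subseteq> C \<and> prime_end_converges \<Omega> s l \<longrightarrow> l \<in> C)"

definition prime_end_topology :: "'a::metric_space set \<Rightarrow> 'a prime_end_point topology" where
  "prime_end_topology \<Omega> =
     topology (\<lambda>U. U \<subseteq> prime_end_closure \<Omega> \<and> prime_end_closed \<Omega> (prime_end_closure \<Omega> - U))"

lemma prime_end_converges_subseq:
  assumes "prime_end_converges \<Omega> s l" "strict_mono (r::nat \<Rightarrow> nat)"
  shows "prime_end_converges \<Omega> (s \<circ> r) l"
proof -
  have r: "n \<le> r j" if "n \<le> j" for n j
    using seq_suble[OF assms(2), of j] that by simp
  from assms(1) show ?thesis
  proof cases
    case (to_point x N u)
    have "(u \<circ> r) \<longlonglongrightarrow> x"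
      using LIMSEQ_subseq_LIMSEQ[OF to_point(4) assms(2)] .
    moreover have "\<forall>j\<ge>N. (s \<circ> r) j = Inl ((u \<circ> r) j) \<and> (u \<circ> r) j \<in> \<Omega>"
      using to_point(3) r by simp
    ultimately show ?thesis
      unfolding to_point(1) using to_point(2) prime_end_converges.to_point by blast
  next
    case (points_to_end \<E> E u)
    have "\<forall>k. \<exists>N. \<forall>j\<ge>N. (u \<circ> r) j \<in> E k"
      using points_to_end(5) r unfolding o_def by meson
    moreover have "\<forall>j. (s \<circ> r) j = Inl ((u \<circ> r) j) \<and> (u \<circ> r) j \<in> \<Omega>"
      using points_to_end(4) by simp
    ultimately show ?thesis
      unfolding points_to_end(1)
      using points_to_end(2,3) prime_end_converges.points_to_end by blast
  next
    case (ends_to_end \<E> E \<F> F)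
    have "\<forall>k. \<exists>N. \<forall>j\<ge>N. \<exists>m. (F \<circ> r) j m \<subseteq> E k"
      using ends_to_end(5) r unfolding o_def by meson
    moreover have "\<forall>j. (s \<circ> r) j = Inr ((\<F> \<circ> r) j) \<and> (\<F> \<circ> r) j \<in> prime_ends \<Omega> \<and>
                        (F \<circ> r) j \<in> (\<F> \<circ> r) j"
      using ends_to_end(4) by simp
    ultimately show ?thesis
      unfolding ends_to_end(1)
      using ends_to_end(2,3) prime_end_converges.ends_to_end by blast
  qed
qed

lemma prime_end_converges_in_closure:
  "prime_end_converges \<Omega> s l \<Longrightarrow> l \<in> prime_end_closure \<Omega>"
  by (induction rule: prime_end_converges.induct) (auto simp: prime_end_closure_def)

lemma prime_end_closed_Un:
  assumes "prime_end_closed \<Omega> A" "prime_end_closed \<Omega> B"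
  shows "prime_end_closed \<Omega> (A \<union> B)"
  unfolding prime_end_closed_def
proof (intro conjI allI impI)
  show "A \<union> B \<subseteq> prime_end_closure \<Omega>"
    using assms by (auto simp: prime_end_closed_def)
next
  fix s l assume sl: "range s \<subseteq> A \<union> B \<and> prime_end_converges \<Omega> s l"
  have *: "l \<in> C" if C: "prime_end_closed \<Omega> C" and inf: "infinite {j. s j \<in> C}" for C
  proof -
    obtain r :: "nat \<Rightarrow> nat" where r: "strict_mono r" "\<And>n. r n \<in> {j. s j \<in> C}"
      using infinite_enumerate[OF inf] by blast
    have "range (s \<circ> r) \<subseteq> C" using r(2) by auto
    then show ?thesis
      using C prime_end_converges_subseq[OF _ r(1)] sl unfolding prime_end_closed_def by blast
  qed
  have "{j. s j \<in> A} \<union> {j. s j \<in> B} = UNIV" using sl by blast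
  then have "infinite {j. s j \<in> A} \<or> infinite {j. s j \<in> B}"
    by (metis finite_Un infinite_UNIV_nat)
  then show "l \<in> A \<union> B" using * assms by blast
qed

lemma istopology_prime_end:
  "istopology (\<lambda>U. U \<subseteq> prime_end_closure \<Omega> \<and> prime_end_closed \<Omega> (prime_end_closure \<Omega> - U))"
  unfolding istopology_def
proof (intro conjI allI impI)
  fix S T
  assume "S \<subseteq> prime_end_closure \<Omega> \<and> prime_end_closed \<Omega> (prime_end_closure \<Omega> - S)"
     and "T \<subseteq> prime_end_closure \<Omega> \<and> prime_end_closed \<Omega> (prime_end_closure \<Omega> - T)"
  then show "prime_end_closed \<Omega> (prime_end_closure \<Omega> - S \<inter> T)"
    using prime_end_closed_Un by (metis Diff_Int)
next
  fix \<K>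
  assume *: "\<forall>K\<in>\<K>. K \<subseteq> prime_end_closure \<Omega> \<and> prime_end_closed \<Omega> (prime_end_closure \<Omega> - K)"
  then show "\<Union>\<K> \<subseteq> prime_end_closure \<Omega>" by blast
  show "prime_end_closed \<Omega> (prime_end_closure \<Omega> - \<Union>\<K>)"
    unfolding prime_end_closed_def
  proof (intro conjI allI impI)
    fix s l assume sl: "range s \<subseteq> prime_end_closure \<Omega> - \<Union>\<K> \<and> prime_end_converges \<Omega> s l"
    have "l \<notin> K" if "K \<in> \<K>" for K
    proof -
      have "prime_end_closed \<Omega> (prime_end_closure \<Omega> - K)" using * that by blast
      moreover have "range s \<subseteq> prime_end_closure \<Omega> - K" using sl that by blast
      ultimately show ?thesis using sl unfolding prime_end_closed_def by blast
    qed
    moreover have "l \<in> prime_end_closure \<Omega>"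
      using sl prime_end_converges_in_closure[of \<Omega> s l] by simp
    ultimately show "l \<in> prime_end_closure \<Omega> - \<Union>\<K>" by simp
  qed blast
qed auto

lemma openin_prime_end_topology:
  "openin (prime_end_topology \<Omega>) U \<longleftrightarrow>
     U \<subseteq> prime_end_closure \<Omega> \<and> prime_end_closed \<Omega> (prime_end_closure \<Omega> - U)"
  by (simp add: prime_end_topology_def topology_inverse'[OF istopology_prime_end])

lemma topspace_prime_end_topology: "topspace (prime_end_topology \<Omega>) = prime_end_closure \<Omega>"
  by (auto simp: topspace_def openin_prime_end_topology prime_end_closed_def)

lemma closedin_prime_end_topology:
  "closedin (prime_end_topology \<Omega>) C \<longleftrightarrow> prime_end_closed \<Omega> C"
  by (auto simp: closedin_def topspace_prime_end_topology openin_prime_end_topology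
        prime_end_closed_def double_diff dest: prime_end_converges_in_closure)

end

theory Submission
  imports Defs
begin

text \<open>The only conditions on a chain that a BQS homeomorphism could destroy are those on its
  closures at \<open>\<partial>\<Omega>\<close> and at infinity. All other conditions are expressed through connectedness,
  relative boundaries, Mazurkiewicz-bounded sets and positive Mazurkiewicz distance. The map
  and its inverse (again BQS) preserve Mazurkiewicz-boundedness; they preserve positive distance of
  \<open>A\<close> and \<open>B\<close> as soon as every continuum joining \<open>A\<close> and \<open>B\<close> meets one fixed bounded set. The
  compact sets in the definitions of chains provide such a bounded set.

  A chain can thus change its kind under the map: an unbounded chain may get an empty
  impression and a chain at infinity a non-empty one. In both cases it is equivalent to a chain of
  the other kind. In the first case the new chain consists of components of the complements of the
  separators \<open>R\<^sub>k\<close>; in the second, of components of the complements of Mazurkiewicz spheres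
  about a fixed point. Hence \<open>f\<close> induces a bijection between ends that respects divisibility in both
  directions, so it preserves prime ends and convergence. A chain with a one-point impression
  has a bounded member, and its image shrinks to a point by the distortion estimate.\<close>

section \<open>Mazurkiewicz-bounded and Mazurkiewicz-separated sets\<close>

text \<open>The BQS inequality compares only continua that meet, so by itself it gives no estimate
  uniform over an unbounded domain: far out, continua of a fixed size may have arbitrarily small
  images. This is the obstacle to transporting positive Mazurkiewicz distance, and the separators in
  the definitions of chains are what removes it. Where a member of a chain is bounded and comes
  without a separator, its relative frontier is itself Mazurkiewicz-bounded. Closures in the ambient
  space are invisible to \<open>f\<close>, which has no given extension to the frontier. Conditions
  are therefore restated inside the domain, where properness lets a relatively closed
  Mazurkiewicz-bounded set and its compact closure stand for each other. Balls of the Mazurkiewicz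
  metric replace metric balls because the trace of a metric ball on the domain can be disconnected
  and of infinite Mazurkiewicz diameter. Equivalence of chains is the right freedom for the repair:
  divisibility, primality and convergence to an end depend on inclusions up to a change of index
  only.\<close>

lemma proper_set_closed:
  fixes A :: "'a::metric_space set"
  assumes "proper_set (UNIV :: 'a set)" "closed A"
  shows "proper_set A"
  using assms unfolding proper_set_def by (metis closedin_closed_trans closed_closedin subtopology_UNIV)

lemma proper_compact:
  fixes S :: "'a::metric_space set"
  assumes "proper_set (UNIV :: 'a set)" "closed S" "bounded S"
  shows "compact S"
  using assms unfolding proper_set_def by (metis closed_closedin subtopology_UNIV)

text \<open>The first premise covers the empty set, whose \<open>diameter\<close> is
  \<open>0\<close>.\<close>

lemma diameter_le_dist:
  fixes S :: "'a::metric_space set"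
  assumes "S \<noteq> {} \<or> 0 \<le> d" "\<And>x y. x \<in> S \<Longrightarrow> y \<in> S \<Longrightarrow> dist x y \<le> d"
  shows "diameter S \<le> d"
  using assms by (auto simp: diameter_def intro: cSUP_least)

lemma diameter_Un_le:
  fixes P Q :: "'a::metric_space set"
  assumes "bounded P" "bounded Q" "P \<inter> Q \<noteq> {}"
  shows "diameter (P \<union> Q) \<le> diameter P + diameter Q"
proof -
  obtain z where z: "z \<in> P" "z \<in> Q" using assms(3) by blast
  have bound: "dist x y \<le> diameter P + diameter Q" if "x \<in> P \<union> Q" "y \<in> P \<union> Q" for x y
  proof -
    have P: "dist x y \<le> diameter P" if "x \<in> P" "y \<in> P" for x y
      using diameter_bounded_bound[OF assms(1)] that by blast
    have Q: "dist x y \<le> diameter Q" if "x \<in> Q" "y \<in> Q" for x y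
      using diameter_bounded_bound[OF assms(2)] that by blast
    show ?thesis
      using that P[of x y] Q[of x y] P[of x z] Q[of x z] P[of z y] Q[of z y]
        dist_triangle[of x y z] diameter_ge_0[OF assms(1)] diameter_ge_0[OF assms(2)] z
      by force
  qed
  have ne: "P \<union> Q \<noteq> {}" using z by blast
  show ?thesis
    using ne bound by (intro diameter_le_dist) auto
qed

lemma diameter_ball_le:
  fixes P :: "'a::metric_space set"
  assumes "P \<subseteq> ball x r" "0 \<le> r"
  shows "diameter P \<le> 2 * r"
proof (rule diameter_le_dist)
  fix a b assume "a \<in> P" "b \<in> P"
  then have "dist x a < r" "dist x b < r" using assms(1) by auto
  then show "dist a b \<le> 2 * r" using dist_triangle3[of a b x] by simp
qed (use assms in auto)

lemma decreasing_closed_Int_compact: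
  fixes C :: "nat \<Rightarrow> 'a::t2_space set"
  assumes "compact K" "\<And>k. closed (C k)" "antimono C" "K \<inter> (\<Inter>k. C k) = {}"
  shows "\<exists>k. K \<inter> C k = {}"
proof (rule ccontr)
  assume no: "\<nexists>k. K \<inter> C k = {}"
  have "K \<inter> (\<Inter>k\<in>UNIV. C k) \<noteq> {}"
  proof (rule compact_imp_fip_image[OF assms(1)])
    fix I :: "nat set" assume "finite I"
    then obtain n where "\<forall>i\<in>I. i \<le> n" using finite_nat_set_iff_bounded_le by blast
    then have "C n \<subseteq> (\<Inter>i\<in>I. C i)" using assms(3) by (auto simp: antimono_def)
    then show "K \<inter> (\<Inter>i\<in>I. C i) \<noteq> {}" using no by blast
  qed (use assms(2) in auto)
  with assms(4) show False by simp
qed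

text \<open>The form in which compactness is used throughout: with \<open>K\<close> the closure of a
  bounded set, an empty impression forces some member of the chain away from that set.\<close>

lemma decreasing_closure_compact:
  fixes E :: "nat \<Rightarrow> 'a::metric_space set"
  assumes "compact K" "antimono E" "K \<inter> (\<Inter>k. closure (E k)) = {}"
  shows "\<exists>k. K \<inter> closure (E k) = {}"
  using assms by (intro decreasing_closed_Int_compact) (auto simp: antimono_def intro!: closure_mono)

text \<open>It is enough for \<open>S\<close> to touch \<open>closure T\<close>: a touching point
  outside \<open>T\<close> is itself on the frontier. Continua that only reach the frontier of a
  smaller set are handled this way.\<close>

lemma connected_meets_frontier:
  assumes "connected S" "S \<inter> closure T \<noteq> {}" "S - T \<noteq> {}"
  shows "S \<inter> frontier T \<noteq> {}"
proof (cases "S \<inter> T = {}")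
  case True
  then show ?thesis using assms(2) closure_Un_frontier by blast
next
  case False
  then show ?thesis using connected_Int_frontier[OF assms(1) False assms(3)] by simp
qed

lemma connected_disjoint_frontier_subset:
  assumes "connected S" "S \<inter> T \<noteq> {}" "S \<inter> frontier T = {}"
  shows "S \<subseteq> T"
  using connected_Int_frontier[OF assms(1,2)] assms(3) by blast

lemma continuum_bounded: "continuum P \<Longrightarrow> bounded P"
  by (simp add: continuum_def compact_imp_bounded)

lemma continuum_Un: "continuum P \<Longrightarrow> continuum Q \<Longrightarrow> P \<inter> Q \<noteq> {} \<Longrightarrow> continuum (P \<union> Q)"
  by (simp add: continuum_def compact_Un connected_Un)

lemma diameter_continuum_Un:
  "continuum P \<Longrightarrow> continuum Q \<Longrightarrow> P \<inter> Q \<noteq> {} \<Longrightarrow> diameter (P \<union> Q) \<le> diameter P + diameter Q"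
  by (simp add: diameter_Un_le continuum_bounded)

text \<open>Finiteness of \<open>mazurkiewicz_diam\<close> with a real bound and explicit continua,
  so that images can be taken one continuum at a time.\<close>

definition mbounded :: "'a::metric_space set \<Rightarrow> 'a set \<Rightarrow> bool" where
  "mbounded \<Omega> Q \<longleftrightarrow>
     (\<exists>D. \<forall>x\<in>Q. \<forall>y\<in>Q. \<exists>P. continuum P \<and> P \<subseteq> \<Omega> \<and> x \<in> P \<and> y \<in> P \<and> diameter P \<le> D)"

text \<open>Positivity of \<open>mazurkiewicz_setdist\<close> without \<open>ennreal\<close>. Sets
  joined by no continuum count as separated, in agreement with the infinite infimum.\<close>

definition mseparated :: "'a::metric_space set \<Rightarrow> 'a set \<Rightarrow> 'a set \<Rightarrow> bool" where
  "mseparated \<Omega> A B \<longleftrightarrow>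
     (\<exists>\<delta>>0. \<forall>C. continuum C \<and> C \<subseteq> \<Omega> \<and> C \<inter> A \<noteq> {} \<and> C \<inter> B \<noteq> {} \<longrightarrow> \<delta> \<le> diameter C)"

lemma mazurkiewicz_diam_finite_iff: "mazurkiewicz_diam \<Omega> Q < \<infinity> \<longleftrightarrow> mbounded \<Omega> Q"
proof
  assume "mazurkiewicz_diam \<Omega> Q < \<infinity>"
  then obtain D where D: "mazurkiewicz_diam \<Omega> Q = ennreal D" "0 \<le> D"
    by (cases "mazurkiewicz_diam \<Omega> Q") auto
  \<comment> \<open>The infimum in \<open>mazurkiewicz_dist\<close> need not be attained; the extra
    \<open>1\<close> leaves room to pick a continuum.\<close>
  show "mbounded \<Omega> Q" unfolding mbounded_def
  proof (intro exI[of _ "D + 1"] ballI)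
    fix x y assume xy: "x \<in> Q" "y \<in> Q"
    have "mazurkiewicz_dist \<Omega> x y \<le> mazurkiewicz_diam \<Omega> Q"
      unfolding mazurkiewicz_diam_def by (rule SUP_upper2[OF xy(1)], rule SUP_upper[OF xy(2)])
    also have "\<dots> < ennreal (D + 1)" using D by (simp add: ennreal_less_iff)
    finally obtain P where "continuum P" "P \<subseteq> \<Omega>" "x \<in> P" "y \<in> P"
        "ennreal (diameter P) < ennreal (D + 1)"
      unfolding mazurkiewicz_dist_def INF_less_iff by blast
    moreover from this have "diameter P < D + 1"
      using ennreal_less_iff diameter_ge_0 continuum_bounded by blast
    ultimately show "\<exists>P. continuum P \<and> P \<subseteq> \<Omega> \<and> x \<in> P \<and> y \<in> P \<and> diameter P \<le> D + 1"
      by (intro exI[of _ P]) simp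
  qed
next
  assume "mbounded \<Omega> Q"
  then obtain D where
    D: "\<forall>x\<in>Q. \<forall>y\<in>Q. \<exists>P. continuum P \<and> P \<subseteq> \<Omega> \<and> x \<in> P \<and> y \<in> P \<and> diameter P \<le> D"
    unfolding mbounded_def by blast
  have "mazurkiewicz_diam \<Omega> Q \<le> ennreal D"
    unfolding mazurkiewicz_diam_def
  proof (intro SUP_least)
    fix x y assume "x \<in> Q" "y \<in> Q"
    then obtain P where "continuum P" "P \<subseteq> \<Omega>" "x \<in> P" "y \<in> P" "diameter P \<le> D" using D by blast
    then show "mazurkiewicz_dist \<Omega> x y \<le> ennreal D"
      unfolding mazurkiewicz_dist_def by (intro INF_lower2[of P]) (auto intro: ennreal_leI)
  qed
  then show "mazurkiewicz_diam \<Omega> Q < \<infinity>"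
    by (metis ennreal_less_top infinity_ennreal_def order_le_less_trans)
qed

lemma mazurkiewicz_setdist_pos_iff: "mazurkiewicz_setdist \<Omega> A B > 0 \<longleftrightarrow> mseparated \<Omega> A B"
proof
  assume "mazurkiewicz_setdist \<Omega> A B > 0"
  then obtain e where e: "0 < e" "e < mazurkiewicz_setdist \<Omega> A B" using dense by blast
  then obtain d where d: "e = ennreal d" "0 < d" by (cases e) (auto simp: ennreal_zero_less_top)
  show "mseparated \<Omega> A B" unfolding mseparated_def
  proof (intro exI[of _ d] conjI allI impI)
    fix C assume C: "continuum C \<and> C \<subseteq> \<Omega> \<and> C \<inter> A \<noteq> {} \<and> C \<inter> B \<noteq> {}"
    then have "mazurkiewicz_setdist \<Omega> A B \<le> ennreal (diameter C)"
      unfolding mazurkiewicz_setdist_def by (intro INF_lower) auto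
    then have "ennreal d \<le> ennreal (diameter C)" using e d by (metis order.strict_implies_order order.trans)
    then show "d \<le> diameter C"
      using C by (simp add: ennreal_le_iff diameter_ge_0 continuum_bounded)
  qed (use d in auto)
next
  assume "mseparated \<Omega> A B"
  then obtain d where "d > 0"
    "\<forall>C. continuum C \<and> C \<subseteq> \<Omega> \<and> C \<inter> A \<noteq> {} \<and> C \<inter> B \<noteq> {} \<longrightarrow> d \<le> diameter C"
    unfolding mseparated_def by blast
  then have "ennreal d \<le> mazurkiewicz_setdist \<Omega> A B"
    unfolding mazurkiewicz_setdist_def by (intro INF_greatest) (auto intro!: ennreal_leI)
  then show "mazurkiewicz_setdist \<Omega> A B > 0" using \<open>d > 0\<close>
    by (metis ennreal_less_zero_iff order_less_le_trans)
qed

lemma mbounded_imp_bounded: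
  assumes "mbounded \<Omega> Q" shows "bounded Q"
proof -
  obtain D where
    D: "\<forall>x\<in>Q. \<forall>y\<in>Q. \<exists>P. continuum P \<and> P \<subseteq> \<Omega> \<and> x \<in> P \<and> y \<in> P \<and> diameter P \<le> D"
    using assms unfolding mbounded_def by blast
  have "dist x y \<le> D" if "x \<in> Q" "y \<in> Q" for x y
  proof -
    obtain P where "continuum P" "x \<in> P" "y \<in> P" "diameter P \<le> D" using D \<open>x \<in> Q\<close> \<open>y \<in> Q\<close> by blast
    then show ?thesis using diameter_bounded_bound[of P x y] continuum_bounded[of P] by simp
  qed
  then show ?thesis using bounded_two_points by blast
qed

lemma mbounded_subset: "mbounded \<Omega> Q \<Longrightarrow> Q' \<subseteq> Q \<Longrightarrow> mbounded \<Omega> Q'"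
  unfolding mbounded_def by (meson subsetD)

text \<open>The open ball of the Mazurkiewicz metric. As a union of continua through
  \<open>x\<close> it is visibly connected and contained in \<open>\<Omega>\<close>.\<close>

definition mazur_ball :: "'a::metric_space set \<Rightarrow> 'a \<Rightarrow> real \<Rightarrow> 'a set" where
  "mazur_ball \<Omega> x r = \<Union>{P. continuum P \<and> P \<subseteq> \<Omega> \<and> x \<in> P \<and> diameter P < r}"

lemma mazur_ball_mono: "r \<le> s \<Longrightarrow> mazur_ball \<Omega> x r \<subseteq> mazur_ball \<Omega> x s"
  unfolding mazur_ball_def by (intro Union_mono) auto

lemma mazur_ball_subset: "mazur_ball \<Omega> x r \<subseteq> \<Omega>"
  unfolding mazur_ball_def by blast

lemma connected_mazur_ball: "connected (mazur_ball \<Omega> x r)"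
  unfolding mazur_ball_def by (rule connected_Union) (auto simp: continuum_def)

lemma centre_in_mazur_ball: "x \<in> \<Omega> \<Longrightarrow> 0 < r \<Longrightarrow> x \<in> mazur_ball \<Omega> x r"
  unfolding mazur_ball_def by (auto simp: continuum_def intro!: exI[of _ "{x}"])

lemma mbounded_mazur_ball: "mbounded \<Omega> (mazur_ball \<Omega> x r)"
  unfolding mbounded_def
proof (intro exI[of _ "2 * r"] ballI)
  fix y z assume "y \<in> mazur_ball \<Omega> x r" "z \<in> mazur_ball \<Omega> x r"
  then obtain P Q where "continuum P" "P \<subseteq> \<Omega>" "x \<in> P" "y \<in> P" "diameter P < r"
    "continuum Q" "Q \<subseteq> \<Omega>" "x \<in> Q" "z \<in> Q" "diameter Q < r"
    unfolding mazur_ball_def by blast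
  then show "\<exists>P. continuum P \<and> P \<subseteq> \<Omega> \<and> y \<in> P \<and> z \<in> P \<and> diameter P \<le> 2 * r"
    using continuum_Un[of P Q] diameter_continuum_Un[of P Q]
    by (intro exI[of _ "P \<union> Q"]) fastforce
qed

text \<open>The triangle inequality of the Mazurkiewicz metric, by gluing two continua at
  \<open>y\<close>; strictness for the first one makes the sum strict.\<close>

lemma mazur_ball_add:
  assumes "y \<in> mazur_ball \<Omega> x r" "continuum Q" "Q \<subseteq> \<Omega>" "y \<in> Q" "diameter Q \<le> s" "z \<in> Q"
  shows "z \<in> mazur_ball \<Omega> x (r + s)"
proof -
  obtain P where P: "continuum P" "P \<subseteq> \<Omega>" "x \<in> P" "y \<in> P" "diameter P < r"
    using assms(1) unfolding mazur_ball_def by blast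
  then have "continuum (P \<union> Q)" "diameter (P \<union> Q) < r + s"
    using continuum_Un[of P Q] diameter_continuum_Un[of P Q] assms by fastforce+
  then show ?thesis unfolding mazur_ball_def using P assms by blast
qed

section \<open>Joining points by continua in a domain\<close>

locale proper_domain =
  fixes \<Omega> :: "'a::metric_space set"
  assumes proper: "proper_set (UNIV :: 'a set)"
    and lpc: "locally path_connected (UNIV :: 'a set)"
    and domain: "metric_domain \<Omega>"
begin

lemma open_domain: "open \<Omega>" and connected_domain: "connected \<Omega>" and domain_nonempty: "\<Omega> \<noteq> {}"
  using domain by (auto simp: metric_domain_def)

lemma open_component:
  fixes U :: "'a set"
  assumes "open U" "C \<in> components U" shows "open C"
  using locally_path_connected_imp_locally_connected[OF lpc] assms
  unfolding locally_connected_open_component by auto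

text \<open>Connected components of an open subset of a locally path-connected space are path
  components, and a path image is a continuum.\<close>

lemma continuum_in_open:
  fixes U :: "'a set"
  assumes "open U" "connected E" "E \<subseteq> U" "a \<in> E" "b \<in> E"
  shows "\<exists>P. continuum P \<and> P \<subseteq> U \<and> a \<in> P \<and> b \<in> P"
proof -
  have "locally path_connected U"
    using assms(1) by (intro locally_open_subset[OF lpc]) simp
  moreover have "connected_component U a b"
    using assms unfolding connected_component_def by blast
  ultimately have "path_component U a b"
    using path_component_eq_connected_component by metis
  then obtain p where "path p" "path_image p \<subseteq> U" "pathstart p = a" "pathfinish p = b"
    unfolding path_component_def by blast
  then show ?thesis
    by (intro exI[of _ "path_image p"]) (auto simp: continuum_def)
qed

lemma continuum_through: "a \<in> \<Omega> \<Longrightarrow> b \<in> \<Omega> \<Longrightarrow> \<exists>P. continuum P \<and> P \<subseteq> \<Omega> \<and> a \<in> P \<and> b \<in> P"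
  using continuum_in_open[OF open_domain connected_domain] by blast

text \<open>The joining continuum is found in the open set
  \<open>\<Omega> \<inter> ball x r\<close>. It may leave \<open>E\<close>, but staying in the ball
  bounds its diameter.\<close>

lemma continuum_in_ball:
  assumes "connected E" "E \<subseteq> \<Omega>" "E \<subseteq> ball x r" "0 \<le> r" "a \<in> E" "b \<in> E"
  shows "\<exists>P. continuum P \<and> P \<subseteq> \<Omega> \<and> a \<in> P \<and> b \<in> P \<and> diameter P \<le> 2 * r"
proof -
  obtain P where "continuum P" "P \<subseteq> \<Omega> \<inter> ball x r" "a \<in> P" "b \<in> P"
    using continuum_in_open[of "\<Omega> \<inter> ball x r" E a b] open_domain assms by blast
  then show ?thesis using diameter_ball_le[of P x r] assms(4) by auto
qed

text \<open>For connected sets metric and Mazurkiewicz boundedness thus agree. This is why a map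
  that respects the latter also respects boundedness of the members of chains.\<close>

lemma mbounded_connected:
  assumes "connected E" "E \<subseteq> \<Omega>" "bounded E"
  shows "mbounded \<Omega> E"
proof -
  obtain x r where r: "E \<subseteq> ball x r" "0 < r"
    using bounded_subset_ballD[OF assms(3)] by blast
  then show ?thesis
    unfolding mbounded_def using continuum_in_ball[OF assms(1,2) r(1)] less_imp_le[OF r(2)] by blast
qed

text \<open>The relative closure of a connected set is again connected. The intended use is for the
  relative frontier, which is a subset of it but may be disconnected.\<close>

lemma mbounded_closure:
  assumes "connected E" "E \<subseteq> \<Omega>" "bounded E"
  shows "mbounded \<Omega> (\<Omega> \<inter> closure E)"
proof (rule mbounded_connected)
  show "connected (\<Omega> \<inter> closure E)"
    by (rule connected_intermediate_closure[OF assms(1)]) (use assms(2) closure_subset in auto)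
  show "bounded (\<Omega> \<inter> closure E)"
    by (rule bounded_subset[OF bounded_closure[OF assms(3)]]) simp
qed blast

lemma small_connected_nbhd:
  assumes "x \<in> \<Omega>" "0 < e"
  shows "\<exists>V. open V \<and> connected V \<and> x \<in> V \<and> V \<subseteq> \<Omega> \<inter> ball x e"
proof -
  have "open (\<Omega> \<inter> ball x e)" "x \<in> \<Omega> \<inter> ball x e" using open_domain assms by auto
  then obtain V where "open V" "path_connected V" "x \<in> V" "V \<subseteq> \<Omega> \<inter> ball x e"
    using lpc unfolding locally_path_connected by force
  then show ?thesis using path_connected_imp_connected by blast
qed

lemma small_continuum_nbhd:
  assumes "x \<in> \<Omega>" "0 < e"
  shows "\<exists>V. open V \<and> x \<in> V \<and> V \<subseteq> \<Omega> \<and>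
           (\<forall>y\<in>V. \<exists>P. continuum P \<and> P \<subseteq> \<Omega> \<and> x \<in> P \<and> y \<in> P \<and> diameter P \<le> 2 * e)"
proof -
  obtain V where "open V" "connected V" "x \<in> V" "V \<subseteq> \<Omega> \<inter> ball x e"
    using small_connected_nbhd[OF assms] by blast
  then show ?thesis using continuum_in_ball[of V x e x] assms(2) by (intro exI[of _ V]) auto
qed

lemma open_mazur_ball: "open (mazur_ball \<Omega> x r)"
proof (subst open_subopen, intro ballI)
  fix y assume y: "y \<in> mazur_ball \<Omega> x r"
  then obtain P where P: "continuum P" "P \<subseteq> \<Omega>" "x \<in> P" "y \<in> P" "diameter P < r"
    unfolding mazur_ball_def by blast
  \<comment> \<open>Half of the slack \<open>r - diameter P\<close> goes into placing
    \<open>y\<close> in the ball of radius \<open>r - 2 * e\<close>, the other half into the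
    continua of diameter at most \<open>2 * e\<close> near \<open>y\<close>.\<close>
  define e where "e = (r - diameter P) / 4"
  have "e > 0" using P by (simp add: e_def)
  have yP: "y \<in> mazur_ball \<Omega> x (r - 2 * e)"
    unfolding mazur_ball_def using P by (auto simp: e_def field_simps intro!: exI[of _ P])
  obtain V where "open V" "y \<in> V" "V \<subseteq> \<Omega>"
    "\<forall>z\<in>V. \<exists>P. continuum P \<and> P \<subseteq> \<Omega> \<and> y \<in> P \<and> z \<in> P \<and> diameter P \<le> 2 * e"
    using small_continuum_nbhd[of y e] \<open>e > 0\<close> P by blast
  moreover have "V \<subseteq> mazur_ball \<Omega> x r"
  proof
    fix z assume "z \<in> V"
    then obtain Q where "continuum Q" "Q \<subseteq> \<Omega>" "y \<in> Q" "z \<in> Q" "diameter Q \<le> 2 * e"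
      using calculation(4) by blast
    then show "z \<in> mazur_ball \<Omega> x r" using mazur_ball_add[OF yP, of Q "2 * e" z] by simp
  qed
  ultimately show "\<exists>T. open T \<and> y \<in> T \<and> T \<subseteq> mazur_ball \<Omega> x r" by blast
qed

text \<open>Points near a point of \<open>\<Omega>\<close> are joined to it by small continua, so a
  relative limit point costs an arbitrarily small increase of the radius. Spheres of different radii
  are thereby kept apart.\<close>

lemma closure_mazur_ball:
  assumes "r < s" shows "\<Omega> \<inter> closure (mazur_ball \<Omega> x r) \<subseteq> mazur_ball \<Omega> x s"
proof
  fix y assume y: "y \<in> \<Omega> \<inter> closure (mazur_ball \<Omega> x r)"
  define e where "e = (s - r) / 2"
  have "e > 0" using assms by (simp add: e_def)
  obtain V where V: "open V" "y \<in> V" "V \<subseteq> \<Omega>"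
    "\<forall>z\<in>V. \<exists>P. continuum P \<and> P \<subseteq> \<Omega> \<and> y \<in> P \<and> z \<in> P \<and> diameter P \<le> 2 * e"
    using small_continuum_nbhd[of y e] \<open>e > 0\<close> y by blast
  then obtain z where z: "z \<in> V" "z \<in> mazur_ball \<Omega> x r"
    using y by (metis Int_iff closure_iff_nhds_not_empty disjoint_iff order_refl)
  then obtain P where "continuum P" "P \<subseteq> \<Omega>" "y \<in> P" "z \<in> P" "diameter P \<le> 2 * e" using V by blast
  then show "y \<in> mazur_ball \<Omega> x s" using mazur_ball_add[OF z(2), of P "s - r" y] by (simp add: e_def)
qed

lemma mbounded_in_mazur_ball:
  assumes "mbounded \<Omega> Q" "Q \<subseteq> \<Omega>" "x \<in> \<Omega>"
  shows "\<exists>r. Q \<subseteq> mazur_ball \<Omega> x r"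
proof (cases "Q = {}")
  case False
  then obtain q where q: "q \<in> Q" by blast
  obtain D where
    D: "\<forall>x\<in>Q. \<forall>y\<in>Q. \<exists>P. continuum P \<and> P \<subseteq> \<Omega> \<and> x \<in> P \<and> y \<in> P \<and> diameter P \<le> D"
    using assms unfolding mbounded_def by blast
  obtain P where P: "continuum P" "P \<subseteq> \<Omega>" "x \<in> P" "q \<in> P"
    using continuum_through[OF assms(3), of q] q assms(2) by blast
  have "q \<in> mazur_ball \<Omega> x (diameter P + 1)"
    unfolding mazur_ball_def using P by force
  then have "y \<in> mazur_ball \<Omega> x (diameter P + 1 + D)" if "y \<in> Q" for y
    using mazur_ball_add[of q \<Omega> x "diameter P + 1" _ D y] D q that by blast
  then show ?thesis by blast
qed auto

text \<open>A point of \<open>\<Omega> - K\<close> lies in an open component, so it is neither a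
  limit of another component nor on the frontier of its own.\<close>

lemma frontier_component_subset:
  assumes "closed K" "C \<in> components (\<Omega> - K)"
  shows "\<Omega> \<inter> frontier C \<subseteq> K"
proof (rule ccontr)
  assume "\<not> ?thesis"
  then obtain x where x: "x \<in> \<Omega> - K" "x \<in> frontier C" by blast
  have op: "open (\<Omega> - K)" using open_domain assms(1) by blast
  have C: "open C" using open_component[OF op assms(2)] .
  obtain B where B: "B \<in> components (\<Omega> - K)" "x \<in> B" using x(1) Union_components by blast
  then have "open B" using open_component[OF op] by blast
  then have "B \<inter> C \<noteq> {}" using x(2) B(2) unfolding frontier_def
    by (metis DiffD1 closure_iff_nhds_not_empty disjoint_iff order_refl)
  then have "B = C" using components_nonoverlap B assms(2) by blast
  then show False using x(2) B(2) C by (simp add: frontier_def interior_open)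
qed

end

section \<open>Chains up to boundary behaviour\<close>

text \<open>The conditions common to both kinds of chains, with closures and frontiers seen only
  inside \<open>\<Omega>\<close>. Nonemptiness is explicit because the acceptability conditions that
  imply it refer to the ambient space or to unboundedness.\<close>

definition mchain :: "'a::metric_space set \<Rightarrow> (nat \<Rightarrow> 'a set) \<Rightarrow> bool" where
  "mchain \<Omega> E \<longleftrightarrow>
     (\<forall>k. connected (E k) \<and> E k \<noteq> {} \<and> E k \<subseteq> \<Omega>) \<and> antimono E \<and>
     (\<forall>k. mseparated \<Omega> (\<Omega> \<inter> frontier (E k)) (\<Omega> \<inter> frontier (E (Suc k)))) \<and>
     \<Omega> \<inter> (\<Inter>k. closure (E k)) = {}"

text \<open>The compact separator is replaced by its trace on \<open>\<Omega>\<close>, an object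
  that a homeomorphism of domains can carry along. In a proper space \<open>closure R\<close> is a
  compact set with trace \<open>R\<close>.\<close>

definition crosscut :: "'a::metric_space set \<Rightarrow> 'a set \<Rightarrow> 'a set \<Rightarrow> bool" where
  "crosscut \<Omega> A B \<longleftrightarrow>
     (\<exists>R\<subseteq>\<Omega>. closedin (top_of_set \<Omega>) R \<and> mbounded \<Omega> R \<and>
        (\<exists>C1\<in>components (\<Omega> - R). \<exists>C2\<in>components (\<Omega> - R). C1 \<noteq> C2 \<and> A \<subseteq> C1 \<and> B \<subseteq> C2))"

lemma crosscutI:
  assumes "R \<subseteq> \<Omega>" "closedin (top_of_set \<Omega>) R" "mbounded \<Omega> R"
    "C1 \<in> components (\<Omega> - R)" "C2 \<in> components (\<Omega> - R)" "C1 \<noteq> C2" "A \<subseteq> C1" "B \<subseteq> C2"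
  shows "crosscut \<Omega> A B"
  using assms unfolding crosscut_def by metis

text \<open>What is retained of \<open>end_chain\<close>: nothing is said about the impression
  outside \<open>\<Omega>\<close>, as it may become empty under the map.\<close>

definition mchain_finite :: "'a::metric_space set \<Rightarrow> (nat \<Rightarrow> 'a set) \<Rightarrow> bool" where
  "mchain_finite \<Omega> E \<longleftrightarrow> mchain \<Omega> E \<and>
     (\<forall>k. bounded (E k) \<or> crosscut \<Omega> (\<Omega> \<inter> frontier (E k)) (\<Omega> \<inter> frontier (E (Suc k))))"

text \<open>What is retained of \<open>end_chain_at_infinity\<close>. Leaving every
  Mazurkiewicz-bounded set takes the place of an empty impression, which refers to ambient
  closures.\<close>

definition mchain_infinite :: "'a::metric_space set \<Rightarrow> (nat \<Rightarrow> 'a set) \<Rightarrow> bool" where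
  "mchain_infinite \<Omega> E \<longleftrightarrow> mchain \<Omega> E \<and>
     (\<forall>k. \<not> bounded (E k) \<and>
        (\<exists>R\<subseteq>\<Omega>. closedin (top_of_set \<Omega>) R \<and> mbounded \<Omega> R \<and> E k \<in> components (\<Omega> - R))) \<and>
     (\<forall>Q\<subseteq>\<Omega>. mbounded \<Omega> Q \<longrightarrow> (\<exists>k. E k \<inter> Q = {}))"

text \<open>Unlike \<open>chain_equiv\<close>, this demands no membership in
  \<open>all_end_chains\<close>, since it has to compare image chains, which may fail to be chains
  of either kind.\<close>

definition chain_equivalent :: "(nat \<Rightarrow> 'a set) \<Rightarrow> (nat \<Rightarrow> 'a set) \<Rightarrow> bool" where
  "chain_equivalent E F \<longleftrightarrow> chain_divides E F \<and> chain_divides F E"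

lemma chain_equivalent_refl: "chain_equivalent E E"
  by (auto simp: chain_equivalent_def chain_divides_def)

lemma chain_equivalent_sym: "chain_equivalent E F \<Longrightarrow> chain_equivalent F E"
  by (simp add: chain_equivalent_def)

lemma chain_equivalent_trans:
  "chain_equivalent E F \<Longrightarrow> chain_equivalent F G \<Longrightarrow> chain_equivalent E G"
  unfolding chain_equivalent_def using chain_divides_trans by blast

lemma mseparated_transfer:
  assumes "mseparated \<Omega> A B"
    "\<And>C. continuum C \<Longrightarrow> C \<subseteq> \<Omega> \<Longrightarrow> C \<inter> A' \<noteq> {} \<Longrightarrow> C \<inter> B' \<noteq> {} \<Longrightarrow> C \<inter> A \<noteq> {} \<and> C \<inter> B \<noteq> {}"
  shows "mseparated \<Omega> A' B'"
  using assms unfolding mseparated_def by metis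

context proper_domain begin

section \<open>Chains in the ambient space and their conditions relative to the domain\<close>

lemma closedin_domain_closure:
  assumes "closedin (top_of_set \<Omega>) R" shows "\<Omega> \<inter> closure R = R"
proof -
  obtain T where "closed T" "R = \<Omega> \<inter> T" using assms by (auto simp: closedin_closed)
  then show ?thesis using closure_minimal[of R T] closure_subset[of R] by blast
qed

lemma compact_closure_bounded: "bounded S \<Longrightarrow> compact (closure S)" for S :: "'a set"
  by (rule proper_compact[OF proper closed_closure bounded_closure])

lemma compact_closure_iff_bounded: "compact (closure S) \<longleftrightarrow> bounded S" for S :: "'a set"
  using compact_closure_bounded[of S] compact_imp_bounded[of "closure S"]
    bounded_subset[OF _ closure_subset[of S]] by blast

lemma proper_closure: "proper_set (closure S)" for S :: "'a set"
  by (rule proper_set_closed[OF proper closed_closure])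

lemma frontier_cross:
  assumes "closedin (top_of_set \<Omega>) R" "C \<in> components (\<Omega> - R)"
  shows "\<Omega> \<inter> frontier C \<subseteq> R"
proof -
  have "\<Omega> - closure R = \<Omega> - R" using closedin_domain_closure[OF assms(1)] by blast
  then have "\<Omega> \<inter> frontier C \<subseteq> closure R"
    using frontier_component_subset[of "closure R" C] assms(2) by simp
  then show ?thesis using closedin_domain_closure[OF assms(1)] by blast
qed

lemma end_chain_imp_mchain_finite:
  assumes "end_chain \<Omega> E" shows "mchain_finite \<Omega> E"
proof -
  have acc: "acceptable \<Omega> (E k)" and dec: "E (Suc k) \<subseteq> E k" for k
    using assms unfolding end_chain_def by auto
  have sep: "mseparated \<Omega> (\<Omega> \<inter> frontier (E k)) (\<Omega> \<inter> frontier (E (Suc k)))" for k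
    using assms unfolding end_chain_def mazurkiewicz_setdist_pos_iff by auto
  have imp: "(\<Inter>k. closure (E k)) \<subseteq> frontier \<Omega>"
    using assms unfolding end_chain_def by auto
  have anti: "antimono E" using dec by (simp add: decseq_SucI)
  have "\<Omega> \<inter> (\<Inter>k. closure (E k)) = {}"
    using imp open_domain by (auto simp: frontier_def interior_open)
  moreover have "connected (E k) \<and> E k \<noteq> {} \<and> E k \<subseteq> \<Omega>" for k
    using acc[of k] unfolding acceptable_def by auto
  ultimately have m: "mchain \<Omega> E" unfolding mchain_def using anti sep by simp
  have "bounded (E k) \<or> crosscut \<Omega> (\<Omega> \<inter> frontier (E k)) (\<Omega> \<inter> frontier (E (Suc k)))" for k
  proof (cases "compact (closure (E k))")
    case True
    then show ?thesis using compact_closure_iff_bounded by simp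
  next
    case False
    then obtain R where R: "compact R" "mbounded \<Omega> (R \<inter> \<Omega>)"
      "\<exists>C1\<in>components (\<Omega> - R). \<exists>C2\<in>components (\<Omega> - R). C1 \<noteq> C2 \<and>
         \<Omega> \<inter> frontier (E k) \<subseteq> C1 \<and> \<Omega> \<inter> frontier (E (Suc k)) \<subseteq> C2"
      using assms unfolding end_chain_def mazurkiewicz_diam_finite_iff by metis
    have "closedin (top_of_set \<Omega>) (R \<inter> \<Omega>)"
      using closedin_closed_Int[OF compact_imp_closed[OF R(1)], of \<Omega>] by (simp add: Int_commute)
    moreover have "\<Omega> - R \<inter> \<Omega> = \<Omega> - R" by blast
    ultimately show ?thesis
      unfolding crosscut_def using R by (intro disjI2 exI[of _ "R \<inter> \<Omega>"]) simp
  qed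
  with m show ?thesis unfolding mchain_finite_def by simp
qed

lemma end_chain_at_infinity_imp_mchain_infinite:
  assumes "end_chain_at_infinity \<Omega> E" shows "mchain_infinite \<Omega> E"
proof -
  have acc: "acceptable_at_infinity \<Omega> (E k)" and dec: "E (Suc k) \<subseteq> E k" for k
    using assms unfolding end_chain_at_infinity_def by auto
  have sep: "mseparated \<Omega> (\<Omega> \<inter> frontier (E k)) (\<Omega> \<inter> frontier (E (Suc k)))" for k
    using assms unfolding end_chain_at_infinity_def mazurkiewicz_setdist_pos_iff by auto
  have imp: "(\<Inter>k. closure (E k)) = {}"
    using assms unfolding end_chain_at_infinity_def by auto
  have anti: "antimono E" using dec by (simp add: decseq_SucI)
  have "connected (E k) \<and> E k \<noteq> {} \<and> E k \<subseteq> \<Omega>" for k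
    using acc[of k] unfolding acceptable_at_infinity_def by auto
  then have m: "mchain \<Omega> E" unfolding mchain_def using anti sep imp by simp
  have "\<not> bounded (E k) \<and>
        (\<exists>R\<subseteq>\<Omega>. closedin (top_of_set \<Omega>) R \<and> mbounded \<Omega> R \<and> E k \<in> components (\<Omega> - R))" for k
  proof -
    obtain K where K: "compact K" "mbounded \<Omega> (K \<inter> \<Omega>)" "E k \<in> components (\<Omega> - K)"
      using acc[of k] unfolding acceptable_at_infinity_def mazurkiewicz_diam_finite_iff by blast
    have "closedin (top_of_set \<Omega>) (K \<inter> \<Omega>)"
      using closedin_closed_Int[OF compact_imp_closed[OF K(1)], of \<Omega>] by (simp add: Int_commute)
    moreover have "\<Omega> - K \<inter> \<Omega> = \<Omega> - K" by blast
    ultimately have "\<exists>R\<subseteq>\<Omega>. closedin (top_of_set \<Omega>) R \<and> mbounded \<Omega> R \<and> E k \<in> components (\<Omega> - R)"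
      using K by (intro exI[of _ "K \<inter> \<Omega>"]) auto
    then show ?thesis using acc[of k] unfolding acceptable_at_infinity_def by blast
  qed
  moreover have "\<exists>k. E k \<inter> Q = {}" if Q: "mbounded \<Omega> Q" for Q
  proof -
    obtain k where "closure Q \<inter> closure (E k) = {}"
      using decreasing_closure_compact[OF compact_closure_bounded[OF mbounded_imp_bounded[OF Q]] anti]
        imp by auto
    then show ?thesis using closure_subset[of Q] closure_subset[of "E k"] by blast
  qed
  ultimately show ?thesis unfolding mchain_infinite_def using m by blast
qed

text \<open>Nested nonempty sets inside the compact set \<open>closure (E k)\<close>. Read
  contrapositively, a chain with empty impression has only unbounded members.\<close>

lemma mchain_nonempty_impression:
  assumes "mchain \<Omega> E" "bounded (E k)"
  shows "(\<Inter>k. closure (E k)) \<noteq> {}"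
proof
  have anti: "antimono E" and ne: "E j \<noteq> {}" for j using assms by (auto simp: mchain_def)
  assume "(\<Inter>k. closure (E k)) = {}"
  then obtain j where "closure (E k) \<inter> closure (E j) = {}"
    using decreasing_closure_compact[OF compact_closure_bounded[OF assms(2)] anti] by blast
  moreover have "E (max j k) \<subseteq> closure (E k) \<inter> closure (E j)"
    using antimonoD[OF anti, of k "max j k"] antimonoD[OF anti, of j "max j k"]
      closure_subset[of "E j"] closure_subset[of "E k"] by auto
  ultimately show False using ne by blast
qed

text \<open>The impression lies in \<open>closure \<Omega>\<close> and misses
  \<open>\<Omega>\<close>, so its points are frontier points, and one of them makes every member
  acceptable. The compact separators are the sets \<open>closure R\<close>.\<close>

lemma mchain_finite_imp_end_chain:
  assumes "mchain_finite \<Omega> E" "(\<Inter>k. closure (E k)) \<noteq> {}"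
  shows "end_chain \<Omega> E"
proof -
  have m: "mchain \<Omega> E" using assms(1) by (simp add: mchain_finite_def)
  have fr: "(\<Inter>k. closure (E k)) \<subseteq> frontier \<Omega>"
  proof
    fix x assume x: "x \<in> (\<Inter>k. closure (E k))"
    then have "x \<notin> \<Omega>" "x \<in> closure \<Omega>"
      using m closure_mono[of "E 0" \<Omega>] by (auto simp: mchain_def)
    then show "x \<in> frontier \<Omega>" using open_domain by (simp add: frontier_def interior_open)
  qed
  have "acceptable \<Omega> (E k)" for k
  proof -
    obtain x where x: "x \<in> (\<Inter>k. closure (E k))" using assms(2) by blast
    then have "x \<in> closure (E k)" "x \<in> frontier \<Omega>" using fr by (auto simp only: INT_iff UNIV_I subset_iff)
    then have "closure (E k) \<inter> frontier \<Omega> \<noteq> {}" by blast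
    then show ?thesis
      unfolding acceptable_def using m proper_closure[of "E k"] by (simp add: mchain_def)
  qed
  moreover have "compact (closure (E k)) \<or>
          (\<not> bounded (E k) \<and>
           (\<exists>R. compact R \<and> mazurkiewicz_diam \<Omega> (R \<inter> \<Omega>) < \<infinity> \<and>
                (\<exists>C1\<in>components (\<Omega> - R). \<exists>C2\<in>components (\<Omega> - R).
                   C1 \<noteq> C2 \<and>
                   \<Omega> \<inter> frontier (E k) \<subseteq> C1 \<and> \<Omega> \<inter> frontier (E (Suc k)) \<subseteq> C2)))" for k
  proof (cases "bounded (E k)")
    case False
    then obtain R where R: "R \<subseteq> \<Omega>" "closedin (top_of_set \<Omega>) R" "mbounded \<Omega> R"
      "\<exists>C1\<in>components (\<Omega> - R). \<exists>C2\<in>components (\<Omega> - R). C1 \<noteq> C2 \<and>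
         \<Omega> \<inter> frontier (E k) \<subseteq> C1 \<and> \<Omega> \<inter> frontier (E (Suc k)) \<subseteq> C2"
      using assms(1) unfolding mchain_finite_def crosscut_def by metis
    have "\<Omega> - closure R = \<Omega> - R" "closure R \<inter> \<Omega> = R"
      using closedin_domain_closure[OF R(2)] by blast+
    then show ?thesis using R False compact_closure_bounded[OF mbounded_imp_bounded[OF R(3)]]
      by (intro disjI2 conjI exI[of _ "closure R"]) (auto simp: mazurkiewicz_diam_finite_iff[simplified])
  qed (simp add: compact_closure_bounded)
  moreover have "E (Suc k) \<subseteq> E k" for k using m by (simp add: mchain_def antimonoD)
  ultimately show ?thesis
    unfolding end_chain_def mazurkiewicz_setdist_pos_iff using m fr assms(2) by (simp add: mchain_def)
qed

text \<open>Unboundedness of the members comes from the empty impression, and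
  \<open>closure R\<close> has the same complement in \<open>\<Omega>\<close> as
  \<open>R\<close>.\<close>

lemma mchain_imp_end_chain_at_infinity:
  assumes "mchain \<Omega> E" "(\<Inter>k. closure (E k)) = {}"
    "\<And>k. \<exists>R\<subseteq>\<Omega>. closedin (top_of_set \<Omega>) R \<and> mbounded \<Omega> R \<and> E k \<in> components (\<Omega> - R)"
  shows "end_chain_at_infinity \<Omega> E"
proof -
  have "acceptable_at_infinity \<Omega> (E k)" for k
  proof -
    obtain R where R: "R \<subseteq> \<Omega>" "closedin (top_of_set \<Omega>) R" "mbounded \<Omega> R" "E k \<in> components (\<Omega> - R)"
      using assms(3) by blast
    have "\<Omega> - closure R = \<Omega> - R" "closure R \<inter> \<Omega> = R"
      using closedin_domain_closure[OF R(2)] by blast+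
    then have "\<exists>K. compact K \<and> mazurkiewicz_diam \<Omega> (K \<inter> \<Omega>) < \<infinity> \<and> E k \<in> components (\<Omega> - K)"
      using R compact_closure_bounded[OF mbounded_imp_bounded[OF R(3)]]
      by (intro exI[of _ "closure R"]) (auto simp: mazurkiewicz_diam_finite_iff[simplified])
    moreover have "\<not> bounded (E k)" using mchain_nonempty_impression[OF assms(1)] assms(2) by blast
    ultimately show ?thesis
      unfolding acceptable_at_infinity_def using assms(1) proper_closure by (auto simp: mchain_def)
  qed
  moreover have "E (Suc k) \<subseteq> E k" for k using assms(1) by (simp add: mchain_def antimonoD)
  ultimately show ?thesis
    unfolding end_chain_at_infinity_def mazurkiewicz_setdist_pos_iff
    using assms by (simp add: mchain_def)
qed

section \<open>Replacing a chain that has changed its kind\<close>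

text \<open>A component other than \<open>C1\<close> avoids the frontier of \<open>E\<close> and
  meets \<open>E\<close>, so it stays inside. The component \<open>C1\<close> cannot meet
  \<open>E'\<close>: avoiding the frontier of \<open>E'\<close>, it would lie in \<open>E'\<close>
  and, being open, in \<open>interior E\<close>, yet it contains the relative frontier of
  \<open>E\<close>, which is nonempty because \<open>\<Omega>\<close> is connected.\<close>

lemma crosscut_component_subset:
  assumes E: "connected E" "E' \<subseteq> E" "E \<noteq> {}" "E \<noteq> \<Omega>" "E \<subseteq> \<Omega>"
    and R: "R \<subseteq> \<Omega>" "closedin (top_of_set \<Omega>) R"
    and C: "C1 \<in> components (\<Omega> - R)" "C2 \<in> components (\<Omega> - R)" "C1 \<noteq> C2"
      "\<Omega> \<inter> frontier E \<subseteq> C1" "\<Omega> \<inter> frontier E' \<subseteq> C2"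
    and D: "D \<in> components (\<Omega> - R)" "D \<inter> E' \<noteq> {}"
  shows "D \<subseteq> E"
proof (cases "D = C1")
  case False
  then have "D \<inter> C1 = {}" using components_nonoverlap C(1) D(1) by blast
  moreover have D': "connected D" "D \<subseteq> \<Omega>" using D(1) in_components_connected in_components_subset by blast+
  ultimately have "D \<inter> frontier E = {}" using C(4) by blast
  then show ?thesis using connected_disjoint_frontier_subset[OF D'(1)] D(2) E(2) by blast
next
  case True
  have C1: "connected C1" "C1 \<subseteq> \<Omega>" "open C1"
    using C(1) in_components_connected in_components_subset apply blast+
    using open_component[OF _ C(1)] R(2) open_domain
    by (metis closedin_closed open_Diff Diff_Int Diff_cancel Un_empty_left)
  have "C1 \<inter> C2 = {}" using components_nonoverlap C by blast
  then have "C1 \<inter> frontier E' = {}" using C(5) C1 by blast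
  then have "C1 \<subseteq> E'" using connected_disjoint_frontier_subset[OF C1(1)] D(2) True by blast
  then have "C1 \<subseteq> interior E" using C1(3) E(2) by (meson interior_maximal order_trans)
  moreover have "\<Omega> \<inter> frontier E \<noteq> {}"
    using connected_Int_frontier[OF connected_domain, of E] E by blast
  ultimately show ?thesis using C(4) unfolding frontier_def by blast
qed

text \<open>When the chain escapes every compact set, its tails eventually avoid the separator
  \<open>R k\<close> and hence lie in one component of the complement, which is trapped inside \<open>E k\<close>.\<close>

lemma mchain_finite_empty_impression:
  assumes E: "mchain_finite \<Omega> E" and imp: "(\<Inter>k. closure (E k)) = {}"
  shows "\<exists>G. end_chain_at_infinity \<Omega> G \<and> chain_equivalent G E"
proof -
  have m: "mchain \<Omega> E" using E by (simp add: mchain_finite_def)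
  then have anti: "antimono E" and con: "connected (E k)" and ne: "E k \<noteq> {}" and sub: "E k \<subseteq> \<Omega>" for k
    by (auto simp: mchain_def)
  have anti': "E j \<subseteq> E i" if "i \<le> j" for i j using antimonoD[OF anti that] .
  have unb: "\<not> bounded (E k)" for k using mchain_nonempty_impression[OF m] imp by blast
  obtain x0 where x0: "x0 \<in> \<Omega>" using domain_nonempty by blast
  \<comment> \<open>From \<open>k0\<close> on the members differ from \<open>\<Omega>\<close>, as
    \<open>crosscut_component_subset\<close> requires.\<close>
  have "\<exists>k0. x0 \<notin> E k0" using imp closure_subset by blast
  then obtain k0 where k0: "x0 \<notin> E k0" by blast
  have proper_sub: "E k \<noteq> \<Omega>" if "k0 \<le> k" for k using anti'[OF that] k0 x0 by blast
  have "\<exists>R D n. k < n \<and> closedin (top_of_set \<Omega>) R \<and> R \<subseteq> \<Omega> \<and> mbounded \<Omega> R \<and>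
          D \<in> components (\<Omega> - R) \<and> R \<inter> E n = {} \<and> E n \<subseteq> D \<and> D \<subseteq> E k" if k: "k0 \<le> k" for k
  proof -
    obtain R C1 C2 where R: "R \<subseteq> \<Omega>" "closedin (top_of_set \<Omega>) R" "mbounded \<Omega> R"
      "C1\<in>components (\<Omega> - R)" "C2\<in>components (\<Omega> - R)" "C1 \<noteq> C2"
      "\<Omega> \<inter> frontier (E k) \<subseteq> C1" "\<Omega> \<inter> frontier (E (Suc k)) \<subseteq> C2"
      using E unb[of k] unfolding mchain_finite_def crosscut_def by metis
    obtain j where "closure R \<inter> closure (E j) = {}"
      using decreasing_closure_compact[OF compact_closure_bounded[OF mbounded_imp_bounded[OF R(3)]] anti]
        imp by auto
    then have j: "R \<inter> E j = {}" using closure_subset[of R] closure_subset[of "E j"] by blast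
    \<comment> \<open>Beyond \<open>j\<close> the tail avoids \<open>R\<close>; beyond
      \<open>k\<close> it lies in the inner set \<open>E (Suc k)\<close> of the crosscut.\<close>
    define n where "n = max j (Suc k)"
    have n: "R \<inter> E n = {}" "E n \<subseteq> E (Suc k)" "k < n"
      using j anti'[of j n] anti'[of "Suc k" n] by (auto simp: n_def)
    have "E n \<subseteq> \<Omega> - R" using n(1) sub[of n] by blast
    then obtain D where D: "D \<in> components (\<Omega> - R)" "E n \<subseteq> D"
      using exists_component_superset[OF _ _ con, of n "\<Omega> - R"] ne[of n] by blast
    have "D \<subseteq> E k"
      by (rule crosscut_component_subset[OF con anti'[of k "Suc k"] ne proper_sub[OF k] sub R(1,2,4-8) D(1)])
        (use D(2) n(2) ne[of n] in auto)
    then show ?thesis using R(1-3) D n by blast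
  qed
  then obtain R D nx where RD: "\<And>k. k0 \<le> k \<Longrightarrow> k < nx k \<and> closedin (top_of_set \<Omega>) (R k) \<and> R k \<subseteq> \<Omega> \<and>
      mbounded \<Omega> (R k) \<and> D k \<in> components (\<Omega> - R k) \<and> R k \<inter> E (nx k) = {} \<and>
      E (nx k) \<subseteq> D k \<and> D k \<subseteq> E k"
    by metis
  \<comment> \<open>The sets will satisfy \<open>E (nx (p i)) \<subseteq> G i\<close> and
    \<open>G (Suc i) \<subseteq> E (Suc (nx (p i)))\<close>. The \<open>Suc\<close> thus leaves one
    full step of \<open>E\<close> between consecutive sets of \<open>G\<close>, and its separation
    is inherited.\<close>
  define p where "p i = ((\<lambda>k. Suc (nx k)) ^^ i) k0" for i
  have pS: "p (Suc i) = Suc (nx (p i))" for i by (simp add: p_def)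
  have pk0: "k0 \<le> p i" for i
  proof (induction i)
    case (Suc i) then show ?case using RD[OF Suc] pS[of i] by simp
  qed (simp add: p_def)
  note RDp = RD[OF pk0]
  have pi: "i \<le> p i" for i
  proof (induction i)
    case (Suc i) then show ?case using RDp[of i] pS[of i] by simp
  qed simp
  define G where "G i = D (p i)" for i
  have G_sub: "G i \<subseteq> E (p i)" and G_sup: "E (nx (p i)) \<subseteq> G i" for i using RDp by (auto simp: G_def)
  have G_con: "connected (G i)" and G_dom: "G i \<subseteq> \<Omega>" and G_ne: "G i \<noteq> {}" for i
    using RDp[of i] in_components_connected[of "D (p i)" "\<Omega> - R (p i)"]
      in_components_subset[of "D (p i)" "\<Omega> - R (p i)"] in_components_nonempty[of "D (p i)" "\<Omega> - R (p i)"]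
    by (auto simp: G_def)
  have frG: "\<Omega> \<inter> frontier (G i) \<subseteq> R (p i)" for i
    using frontier_cross RDp[of i] by (simp add: G_def)
  have "mseparated \<Omega> (\<Omega> \<inter> frontier (G i)) (\<Omega> \<inter> frontier (G (Suc i)))" for i
  proof -
    define n where "n = nx (p i)"
    have "mseparated \<Omega> (\<Omega> \<inter> frontier (E n)) (\<Omega> \<inter> frontier (E (Suc n)))"
      using m by (simp add: mchain_def)
    then show ?thesis
    proof (rule mseparated_transfer)
      fix C assume C: "continuum C" "C \<subseteq> \<Omega>" "C \<inter> (\<Omega> \<inter> frontier (G i)) \<noteq> {}"
        "C \<inter> (\<Omega> \<inter> frontier (G (Suc i))) \<noteq> {}"
      have conC: "connected C" using C(1) by (simp add: continuum_def)
      \<comment> \<open>\<open>C\<close> has a point on the separator, outside \<open>E n\<close>,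
        and a point in \<open>closure (E (Suc n))\<close>; being connected it meets both
        frontiers.\<close>
      obtain x where x: "x \<in> C" "x \<in> R (p i)" using C(3) frG by blast
      then have "x \<notin> E n" using RDp[of i] by (auto simp: n_def)
      then have x': "x \<notin> E (Suc n)" using anti'[of n "Suc n"] by auto
      obtain y where y: "y \<in> C" "y \<in> closure (G (Suc i))"
        using C(4) by (auto simp: frontier_def)
      have "closure (G (Suc i)) \<subseteq> closure (E (Suc n))"
        using G_sub[of "Suc i"] by (simp add: pS n_def closure_mono)
      then have y': "y \<in> closure (E (Suc n))" "y \<in> closure (E n)"
        using y(2) closure_mono[OF anti'[of n "Suc n"]] by auto
      have "C \<inter> frontier (E n) \<noteq> {}"
        by (rule connected_meets_frontier[OF conC]) (use x y y' \<open>x \<notin> E n\<close> in auto)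
      moreover have "C \<inter> frontier (E (Suc n)) \<noteq> {}"
        by (rule connected_meets_frontier[OF conC]) (use x y y' x' in auto)
      ultimately show "C \<inter> (\<Omega> \<inter> frontier (E n)) \<noteq> {} \<and> C \<inter> (\<Omega> \<inter> frontier (E (Suc n))) \<noteq> {}"
        using C(2) by blast
    qed
  qed
  moreover have "antimono G"
  proof (rule decseq_SucI)
    fix i
    have "G (Suc i) \<subseteq> E (Suc (nx (p i)))" using G_sub[of "Suc i"] by (simp add: pS)
    also have "\<dots> \<subseteq> E (nx (p i))" by (simp add: anti')
    finally show "G (Suc i) \<subseteq> G i" using G_sup by blast
  qed
  moreover have GE: "G i \<subseteq> E i" for i using G_sub[of i] anti'[OF pi[of i]] by blast
  then have "(\<Inter>i. closure (G i)) \<subseteq> (\<Inter>i. closure (E i))"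
    by (intro INF_mono' closure_mono)
  then have impG: "(\<Inter>i. closure (G i)) = {}" using imp by simp
  ultimately have mG: "mchain \<Omega> G" unfolding mchain_def using G_con G_dom G_ne by simp
  have "end_chain_at_infinity \<Omega> G"
  proof (rule mchain_imp_end_chain_at_infinity[OF mG impG])
    show "\<exists>R\<subseteq>\<Omega>. closedin (top_of_set \<Omega>) R \<and> mbounded \<Omega> R \<and> G i \<in> components (\<Omega> - R)" for i
      using RDp[of i] by (intro exI[of _ "R (p i)"]) (simp add: G_def)
  qed
  moreover have "chain_equivalent G E"
    unfolding chain_equivalent_def chain_divides_def using GE G_sup by blast
  ultimately show ?thesis by blast
qed

text \<open>A connected set containing the ball and avoiding its frontier cannot leave it. The ball
  will be the inner component of the crosscuts formed by spheres.\<close>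

lemma component_frontier_mazur_ball:
  assumes "x \<in> \<Omega>" "0 < r"
  shows "mazur_ball \<Omega> x r \<in> components (\<Omega> - frontier (mazur_ball \<Omega> x r))"
  unfolding in_components_maximal
proof (intro conjI allI impI)
  show "mazur_ball \<Omega> x r \<noteq> {}" using centre_in_mazur_ball[OF assms] by blast
  show "mazur_ball \<Omega> x r \<subseteq> \<Omega> - frontier (mazur_ball \<Omega> x r)"
    using mazur_ball_subset[of \<Omega> x r] open_mazur_ball[of x r] by (auto simp: frontier_def interior_open)
  fix D assume D: "D \<noteq> {} \<and> mazur_ball \<Omega> x r \<subseteq> D \<and> D \<subseteq> \<Omega> - frontier (mazur_ball \<Omega> x r) \<and> connected D"
  then show "D = mazur_ball \<Omega> x r"
    using connected_disjoint_frontier_subset[of D "mazur_ball \<Omega> x r"] centre_in_mazur_ball[OF assms] by blast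
qed (rule connected_mazur_ball)

text \<open>The separators of the members are not known to separate consecutive frontiers, as a
  chain of unbounded sets with nonempty impression must have it. Spheres about one point do: between
  two of them lies a sphere of intermediate radius.\<close>

lemma mchain_infinite_nonempty_impression:
  assumes E: "mchain_infinite \<Omega> E" and imp: "(\<Inter>k. closure (E k)) \<noteq> {}"
  shows "\<exists>G. end_chain \<Omega> G \<and> chain_equivalent G E"
proof -
  have m: "mchain \<Omega> E" using E by (simp add: mchain_infinite_def)
  then have anti: "antimono E" and con: "connected (E k)" and ne: "E k \<noteq> {}" and sub: "E k \<subseteq> \<Omega>" for k
    by (auto simp: mchain_def)
  have anti': "E j \<subseteq> E i" if "i \<le> j" for i j using antimonoD[OF anti that] .
  have unb: "\<not> bounded (E k)" for k using E by (simp add: mchain_infinite_def)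
  obtain x0 where x0: "x0 \<in> \<Omega>" using domain_nonempty by blast
  define B where "B = mazur_ball \<Omega> x0"
  have Bmono: "r \<le> s \<Longrightarrow> B r \<subseteq> B s" for r s by (simp add: B_def mazur_ball_mono)
  have Bcl: "r < s \<Longrightarrow> \<Omega> \<inter> closure (B r) \<subseteq> B s" for r s using closure_mazur_ball by (simp add: B_def)
  have Bop: "open (B r)" for r using open_mazur_ball by (simp add: B_def)
  have Bsub: "B r \<subseteq> \<Omega>" for r using mazur_ball_subset by (simp add: B_def)
  have Bmb: "mbounded \<Omega> (B r)" for r using mbounded_mazur_ball by (simp add: B_def)
  have "\<exists>D n. D \<in> components (\<Omega> - frontier (B r)) \<and> E n \<subseteq> D \<and> D \<inter> B r = {}" for r
  proof -
    \<comment> \<open>A tail outside \<open>B r\<close> could still meet its frontier; a tail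
      outside \<open>B (r + 1)\<close> cannot.\<close>
    obtain n where n: "E n \<inter> B (r + 1) = {}"
      using E Bmb[of "r + 1"] Bsub[of "r + 1"] unfolding mchain_infinite_def by blast
    have fr: "\<Omega> \<inter> frontier (B r) \<subseteq> B (r + 1)" using Bcl[of r "r + 1"] by (auto simp: frontier_def)
    then have "E n \<subseteq> \<Omega> - frontier (B r)" using n sub[of n] by blast
    then obtain D where D: "D \<in> components (\<Omega> - frontier (B r))" "E n \<subseteq> D"
      using exists_component_superset[OF _ _ con, of n "\<Omega> - frontier (B r)"] ne[of n] by blast
    have D': "connected D" "D \<subseteq> \<Omega> - frontier (B r)"
      using D(1) in_components_connected in_components_subset by blast+
    have "\<not> D \<subseteq> B r" using D(2) n ne[of n] Bmono[of r "r + 1"] by auto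
    then have "D \<inter> B r = {}" using connected_disjoint_frontier_subset[OF D'(1), of "B r"] D'(2) by blast
    with D show ?thesis by blast
  qed
  then obtain D n where D: "\<And>r. D r \<in> components (\<Omega> - frontier (B r))"
    "\<And>r. E (n r) \<subseteq> D r" "\<And>r. D r \<inter> B r = {}" by metis
  have Dcon: "connected (D r)" and Dsub: "D r \<subseteq> \<Omega> - frontier (B r)" for r
    using D(1) in_components_connected in_components_subset by blast+
  \<comment> \<open>The relative closure is included so that the frontier of an outer set falls into
    the component of a smaller radius; the crosscut below relies on it.\<close>
  have D_mono: "\<Omega> \<inter> closure (D t) \<subseteq> D r" if "r < t" for r t
  proof (rule components_maximal[OF D(1)])
    show "connected (\<Omega> \<inter> closure (D t))"
      by (rule connected_intermediate_closure[OF Dcon]) (use Dsub[of t] closure_subset in auto)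
    have "closure (D t) \<inter> B t = {}"
      using D(3)[of t] Bop[of t] by (simp add: Int_commute open_Int_closure_eq_empty)
    then show "\<Omega> \<inter> closure (D t) \<subseteq> \<Omega> - frontier (B r)"
      using Bcl[OF that] by (auto simp: frontier_def)
    have "E (max (n r) (n t)) \<subseteq> D r \<inter> D t"
      using D(2) anti'[of "n r" "max (n r) (n t)"] anti'[of "n t" "max (n r) (n t)"] by fastforce
    then show "D r \<inter> (\<Omega> \<inter> closure (D t)) \<noteq> {}"
      using ne[of "max (n r) (n t)"] Dsub[of t] closure_subset[of "D t"] by blast
  qed
  have "\<exists>q. \<Omega> \<inter> frontier (E k) \<subseteq> B q" for k
  proof -
    obtain R where "closedin (top_of_set \<Omega>) R" "mbounded \<Omega> R" "E k \<in> components (\<Omega> - R)"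
      using E unfolding mchain_infinite_def by blast
    then show ?thesis
      using frontier_cross[of R "E k"] mbounded_subset[of \<Omega> R] mbounded_in_mazur_ball[OF _ _ x0]
      by (simp add: B_def)
  qed
  then obtain q where q: "\<And>k. \<Omega> \<inter> frontier (E k) \<subseteq> B (q k)" by metis
  \<comment> \<open>The sum dominates \<open>q k\<close>, so the frontier of \<open>E k\<close> lies
    in \<open>B (\<rho> k)\<close>. The summands \<open>1\<close> and \<open>real k\<close> make the
    radii positive and strictly increasing.\<close>
  define \<rho> where "\<rho> k = 1 + real k + (\<Sum>j\<le>k. \<bar>q j\<bar>)" for k
  have \<rho>_step: "\<rho> k < \<rho> (Suc k)" for k by (simp add: \<rho>_def)
  have \<rho>_pos: "0 < \<rho> k" for k by (simp add: \<rho>_def add_pos_nonneg sum_nonneg)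
  have "q k \<le> \<rho> k" for k
  proof -
    have "\<bar>q k\<bar> \<le> (\<Sum>j\<le>k. \<bar>q j\<bar>)" by (intro member_le_sum) auto
    then show ?thesis by (simp add: \<rho>_def)
  qed
  then have frE: "\<Omega> \<inter> frontier (E k) \<subseteq> B (\<rho> k)" for k using q Bmono by blast
  define G where "G k = D (\<rho> k)" for k
  have G_sup: "E (n (\<rho> k)) \<subseteq> G k" for k using D(2) by (simp add: G_def)
  have G_sub: "G k \<subseteq> E k" for k
  proof (rule connected_disjoint_frontier_subset)
    show "connected (G k)" using Dcon by (simp add: G_def)
    show "G k \<inter> frontier (E k) = {}" using frE[of k] D(3)[of "\<rho> k"] Dsub[of "\<rho> k"] by (auto simp: G_def)
    have "E (max k (n (\<rho> k))) \<subseteq> G k \<inter> E k"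
      using G_sup[of k] anti'[of k "max k (n (\<rho> k))"] anti'[of "n (\<rho> k)" "max k (n (\<rho> k))"] by fastforce
    then show "G k \<inter> E k \<noteq> {}" using ne[of "max k (n (\<rho> k))"] by blast
  qed
  have Gcon: "connected (G k)" and Gdom: "G k \<subseteq> \<Omega>" and Gne: "G k \<noteq> {}" for k
    using Dcon Dsub[of "\<rho> k"] G_sup[of k] ne[of "n (\<rho> k)"] by (auto simp: G_def)
  have frG: "\<Omega> \<inter> frontier (G k) \<subseteq> frontier (B (\<rho> k))" for k
    using frontier_component_subset[OF frontier_closed D(1)] by (simp add: G_def)
  have sep: "mseparated \<Omega> (\<Omega> \<inter> frontier (G k)) (\<Omega> \<inter> frontier (G (Suc k)))" for k
    unfolding mseparated_def
  \<comment> \<open>One half of the gap moves a point of the inner sphere into an open ball; a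
    continuum no larger than the other half stays inside \<open>B (\<rho> (Suc k))\<close>, which
    contains no point of its own frontier.\<close>
  proof (intro exI[of _ "(\<rho> (Suc k) - \<rho> k) / 2"] conjI allI impI)
    show "0 < (\<rho> (Suc k) - \<rho> k) / 2" using \<rho>_step[of k] by simp
    fix C assume "continuum C \<and> C \<subseteq> \<Omega> \<and> C \<inter> (\<Omega> \<inter> frontier (G k)) \<noteq> {} \<and>
      C \<inter> (\<Omega> \<inter> frontier (G (Suc k))) \<noteq> {}"
    then obtain x y where C: "continuum C" "C \<subseteq> \<Omega>" "x \<in> C" "y \<in> C" "x \<in> \<Omega>" "y \<in> \<Omega>"
      "x \<in> frontier (B (\<rho> k))" "y \<in> frontier (B (\<rho> (Suc k)))" using frG by blast
    define e where "e = (\<rho> (Suc k) - \<rho> k) / 2"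
    have "x \<in> B (\<rho> k + e)" using C(5,7) Bcl[of "\<rho> k" "\<rho> k + e"] \<rho>_step[of k]
      by (auto simp: frontier_def e_def)
    moreover have "y \<notin> B (\<rho> (Suc k))" using C(8) Bop by (simp add: frontier_def interior_open)
    ultimately have "\<not> diameter C \<le> e"
      using mazur_ball_add[of x \<Omega> x0 "\<rho> k + e" C e y] C by (auto simp: B_def e_def field_simps)
    then show "(\<rho> (Suc k) - \<rho> k) / 2 \<le> diameter C" by (simp add: e_def)
  qed
  have "antimono G"
  proof (rule decseq_SucI)
    show "G (Suc k) \<subseteq> G k" for k
      using D_mono[OF \<rho>_step, of k] Gdom[of "Suc k"] closure_subset[of "G (Suc k)"] by (auto simp: G_def)
  qed
  moreover have "(\<Inter>k. closure (G k)) \<subseteq> (\<Inter>k. closure (E k))"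
    using closure_mono[OF G_sub] by (intro INF_mono) auto
  ultimately have mG: "mchain \<Omega> G"
    using m sep Gcon Gdom Gne unfolding mchain_def by blast
  have "(\<Inter>k. closure (E k)) \<subseteq> (\<Inter>k. closure (G k))"
    using closure_mono[OF G_sup] by (intro INF_mono) auto
  then have impG: "(\<Inter>k. closure (G k)) \<noteq> {}" using imp by blast
  have "crosscut \<Omega> (\<Omega> \<inter> frontier (G k)) (\<Omega> \<inter> frontier (G (Suc k)))" for k
  proof -
    \<comment> \<open>The sphere of the mean radius is the separator: the inner frontier lies in
      \<open>B s\<close>, the outer one in \<open>D s\<close>.\<close>
    define s where "s = (\<rho> k + \<rho> (Suc k)) / 2"
    have s: "\<rho> k < s" "s < \<rho> (Suc k)" "0 < s" using \<rho>_step[of k] \<rho>_pos[of k] by (auto simp: s_def)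
    define R where "R = \<Omega> \<inter> frontier (B s)"
    have R: "\<Omega> - R = \<Omega> - frontier (B s)" by (auto simp: R_def)
    have "R \<subseteq> B (s + 1)" using Bcl[of s "s + 1"] by (auto simp: R_def frontier_def)
    then have "mbounded \<Omega> R" using mbounded_subset[OF Bmb] by blast
    moreover have "closedin (top_of_set \<Omega>) R" by (simp add: R_def closedin_closed_Int)
    moreover have "B s \<in> components (\<Omega> - R)"
      unfolding R using component_frontier_mazur_ball[OF x0 s(3)] by (simp add: B_def)
    moreover have "D s \<in> components (\<Omega> - R)" unfolding R by (rule D(1))
    moreover have "B s \<noteq> D s" using D(3)[of s] D(2)[of s] ne[of "n s"] by blast
    moreover have "\<Omega> \<inter> frontier (G k) \<subseteq> B s"
      using frG[of k] Bcl[OF s(1)] by (auto simp: frontier_def)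
    moreover have "\<Omega> \<inter> frontier (G (Suc k)) \<subseteq> D s"
      using D_mono[OF s(2)] by (auto simp: frontier_def G_def)
    ultimately show ?thesis by (intro crosscutI[of R \<Omega> "B s" "D s"]) (simp_all add: R_def)
  qed
  then have "mchain_finite \<Omega> G" using mG by (simp add: mchain_finite_def)
  then have "end_chain \<Omega> G" using impG by (rule mchain_finite_imp_end_chain)
  moreover have "chain_equivalent G E"
    unfolding chain_equivalent_def chain_divides_def using G_sub G_sup by blast
  ultimately show ?thesis by blast
qed

text \<open>Whether the impression is empty decides the kind of chain that is required. If this
  agrees with the retained conditions, \<open>E\<close> itself serves; otherwise one of the two
  replacements applies.\<close>

lemma equivalent_end_chain:
  assumes "mchain_finite \<Omega> E \<or> mchain_infinite \<Omega> E"
  shows "\<exists>G\<in>all_end_chains \<Omega>. chain_equivalent G E"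
proof (cases "(\<Inter>k. closure (E k)) = {}")
  case True
  show ?thesis
  proof (cases "mchain_finite \<Omega> E")
    case False
    then have "end_chain_at_infinity \<Omega> E"
      using assms True by (intro mchain_imp_end_chain_at_infinity) (auto simp: mchain_infinite_def)
    then show ?thesis using chain_equivalent_refl unfolding all_end_chains_def by blast
  qed (use mchain_finite_empty_impression[OF _ True] in \<open>auto simp: all_end_chains_def\<close>)
next
  case False
  show ?thesis
  proof (cases "mchain_finite \<Omega> E")
    case True
    then show ?thesis
      using mchain_finite_imp_end_chain[OF True False] chain_equivalent_refl
      unfolding all_end_chains_def by blast
  qed (use mchain_infinite_nonempty_impression[OF _ False] assms in \<open>auto simp: all_end_chains_def\<close>)
qed

end

section \<open>Distortion of Mazurkiewicz-bounded sets\<close>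

lemma nondegenerate_diameter_pos:
  assumes "nondegenerate_continuum E" shows "0 < diameter E"
proof -
  obtain x y where "x \<in> E" "y \<in> E" "x \<noteq> y" and "continuum E"
    using assms by (auto simp: nondegenerate_continuum_def)
  then have "0 < dist x y" "dist x y \<le> diameter E"
    using diameter_bounded_bound[of E x y] continuum_bounded[of E] by auto
  then show ?thesis by linarith
qed

lemma nondegenerateI:
  assumes "continuum E" "0 < diameter E" shows "nondegenerate_continuum E"
proof -
  obtain x y where "x \<in> E" "y \<in> E" "0 < dist x y"
    using diameter_lower_bounded[OF continuum_bounded[OF assms(1)], of "diameter E / 2"] assms(2)
    by (smt (verit, best) field_sum_of_halves)
  then show ?thesis using assms(1) by (auto simp: nondegenerate_continuum_def)
qed

lemma nondegenerate_continuum_Un: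
  assumes "nondegenerate_continuum E" "continuum F" "E \<inter> F \<noteq> {}"
  shows "nondegenerate_continuum (E \<union> F)"
  using assms continuum_Un[of E F] by (auto simp: nondegenerate_continuum_def)

lemma continuum_image:
  assumes "continuous_on \<Omega> f" "continuum E" "E \<subseteq> \<Omega>" shows "continuum (f ` E)"
  using assms continuous_on_subset[OF assms(1,3)]
  by (auto simp: continuum_def intro: compact_continuous_image connected_continuous_image)

lemma nondegenerate_image:
  assumes "homeomorphism \<Omega> \<Omega>' f g" "nondegenerate_continuum E" "E \<subseteq> \<Omega>"
  shows "nondegenerate_continuum (f ` E)"
proof -
  have "continuum (f ` E)"
    using continuum_image assms by (auto simp: homeomorphism_def nondegenerate_continuum_def)
  moreover obtain x y where xy: "x \<in> E" "y \<in> E" "x \<noteq> y"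
    using assms by (auto simp: nondegenerate_continuum_def)
  then have "f x \<noteq> f y" using assms(1,3) unfolding homeomorphism_def by (metis subsetD)
  ultimately show ?thesis using xy by (auto simp: nondegenerate_continuum_def)
qed

lemma homeomorphism_image_image:
  assumes "homeomorphism \<Omega> \<Omega>' f g" "E \<subseteq> \<Omega>" shows "g ` f ` E = E"
proof -
  have "(\<lambda>x. g (f x)) ` E = (\<lambda>x. x) ` E"
    using assms by (intro image_cong) (auto simp: homeomorphism_def)
  then show ?thesis by (simp add: image_image)
qed

lemma BQS_homeomorphismE:
  assumes "BQS_homeomorphism \<Omega> \<Omega>' f"
  obtains \<eta> :: "real \<Rightarrow> real" where
    "\<And>t. t > 0 \<Longrightarrow> \<eta> t > 0" "mono_on {0<..} \<eta>" "(\<eta> \<longlongrightarrow> 0) (at_right 0)"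
    "\<And>E F. nondegenerate_continuum E \<Longrightarrow> E \<subseteq> \<Omega> \<Longrightarrow> nondegenerate_continuum F \<Longrightarrow> F \<subseteq> \<Omega> \<Longrightarrow>
       E \<inter> F \<noteq> {} \<Longrightarrow> diameter (f ` E) / diameter (f ` F) \<le> \<eta> (diameter E / diameter F)"
proof -
  obtain \<eta> :: "real \<Rightarrow> real" where
    "(\<forall>t>0. \<eta> t > 0) \<and> mono_on {0<..} \<eta> \<and> (\<eta> \<longlongrightarrow> 0) (at_right 0) \<and>
        (\<forall>E F. nondegenerate_continuum E \<and> E \<subseteq> \<Omega> \<and>
               nondegenerate_continuum F \<and> F \<subseteq> \<Omega> \<and> E \<inter> F \<noteq> {} \<longrightarrow>
               diameter (f ` E) / diameter (f ` F) \<le> \<eta> (diameter E / diameter F))"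
    using assms[unfolded BQS_homeomorphism_def, THEN conjunct2] by (rule exE)
  then show thesis by (intro that[of \<eta>]) simp_all
qed

text \<open>If \<open>f\<close> distorts by \<open>\<eta>\<close>, then its inverse distorts by the generalised inverse of
  \<open>t \<mapsto> 1 / \<eta> (1 / t)\<close>; the summand \<open>t\<close> only serves to make it positive.\<close>

lemma BQS_homeomorphism_inverse:
  assumes homeo: "homeomorphism \<Omega> \<Omega>' f g" and BQS: "BQS_homeomorphism \<Omega> \<Omega>' f"
  shows "BQS_homeomorphism \<Omega>' \<Omega> g"
proof -
  obtain \<eta> :: "real \<Rightarrow> real" where \<eta>: "\<And>t. t > 0 \<Longrightarrow> \<eta> t > 0" "mono_on {0<..} \<eta>" "(\<eta> \<longlongrightarrow> 0) (at_right 0)"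
    "\<And>E F. nondegenerate_continuum E \<Longrightarrow> E \<subseteq> \<Omega> \<Longrightarrow> nondegenerate_continuum F \<Longrightarrow> F \<subseteq> \<Omega> \<Longrightarrow>
       E \<inter> F \<noteq> {} \<Longrightarrow> diameter (f ` E) / diameter (f ` F) \<le> \<eta> (diameter E / diameter F)"
    using BQS_homeomorphismE[OF BQS] by metis
  \<comment> \<open>\<open>S t\<close> collects the ratios that the estimate for \<open>f\<close>
    allows once the two continua are exchanged. It is bounded since \<open>\<eta> (1 / s)\<close>
    tends to \<open>0\<close> as \<open>s\<close> grows; \<open>0\<close> is inserted to make the
    supremum meaningful and nonnegative.\<close>
  define S where "S t = insert 0 {s. 0 < s \<and> 1 / t \<le> \<eta> (1 / s)}" for t :: real
  define \<theta> where "\<theta> t = Sup (S t) + t" for t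
  have bdd: "bdd_above (S t)" if "t > 0" for t
  proof -
    have "\<forall>\<^sub>F u in at_right 0. \<eta> u < 1 / t" using \<eta>(3) that by (intro order_tendstoD) auto
    then obtain b where b: "b > 0" "\<And>u. 0 < u \<Longrightarrow> u < b \<Longrightarrow> \<eta> u < 1 / t"
      unfolding eventually_at_right_field by auto
    have "s \<le> 1 / b" if "s \<in> S t" for s
    proof (cases "s = 0")
      case False
      then have s: "0 < s" "1 / t \<le> \<eta> (1 / s)" using that by (auto simp: S_def)
      then have "b \<le> 1 / s" using b(2)[of "1 / s"] by force
      then show ?thesis using s b(1) by (simp add: field_simps)
    qed (use b(1) in simp)
    then show ?thesis by (rule bdd_aboveI)
  qed
  have pos: "0 < \<theta> t" if "t > 0" for t
    using cSup_upper[OF _ bdd[OF that], of 0] that by (simp add: \<theta>_def S_def)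
  have mono: "mono_on {0<..} \<theta>"
  proof (rule mono_onI)
    fix r s :: real assume "r \<in> {0<..}" "s \<in> {0<..}" "r \<le> s"
    then have "1 / s \<le> 1 / r" by (simp add: frac_le)
    then have "S r \<subseteq> S s" by (auto simp: S_def)
    then have "Sup (S r) \<le> Sup (S s)"
      using bdd[of s] \<open>s \<in> {0<..}\<close> by (intro cSup_subset_mono) (auto simp: S_def)
    then show "\<theta> r \<le> \<theta> s" using \<open>r \<le> s\<close> by (simp add: \<theta>_def)
  qed
  have lim: "(\<theta> \<longlongrightarrow> 0) (at_right 0)"
  proof (rule tendstoI)
    fix e :: real assume e: "e > 0"
    \<comment> \<open>The second term of the minimum gives \<open>\<eta> (2 / e) < 1 / t\<close>,
      which by monotonicity excludes every \<open>s > e / 2\<close> from \<open>S t\<close>; the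
      first keeps the summand \<open>t\<close> below \<open>e / 2\<close>.\<close>
    define c where "c = min (e / 2) (1 / \<eta> (2 / e))"
    have c: "c > 0" using e \<eta>(1)[of "2 / e"] by (simp add: c_def)
    have "dist (\<theta> t) 0 < e" if t: "0 < t" "t < c" for t
    proof -
      have "s \<le> e / 2" if "s \<in> S t" for s
      proof (rule ccontr)
        assume "\<not> s \<le> e / 2"
        then have s: "e / 2 < s" "0 < s" "1 / t \<le> \<eta> (1 / s)" using that e by (auto simp: S_def)
        have "1 / s \<le> 2 / e" using s e by (simp add: field_simps)
        then have "\<eta> (1 / s) \<le> \<eta> (2 / e)" using s e by (intro mono_onD[OF \<eta>(2)]) auto
        moreover have "\<eta> (2 / e) < 1 / t"
          using t \<eta>(1)[of "2 / e"] e by (simp add: c_def field_simps)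
        ultimately show False using s by simp
      qed
      then have "Sup (S t) \<le> e / 2" by (intro cSup_least) (auto simp: S_def)
      then show ?thesis using pos[OF t(1)] t(2) by (simp add: \<theta>_def c_def)
    qed
    then show "\<forall>\<^sub>F t in at_right 0. dist (\<theta> t) 0 < e"
      unfolding eventually_at_right_field using c by blast
  qed
  have gh: "homeomorphism \<Omega>' \<Omega> g f" using homeo by (rule homeomorphism_symD)
  have "diameter (g ` E) / diameter (g ` F) \<le> \<theta> (diameter E / diameter F)"
    if E: "nondegenerate_continuum E" "E \<subseteq> \<Omega>'" and F: "nondegenerate_continuum F" "F \<subseteq> \<Omega>'"
      and EF: "E \<inter> F \<noteq> {}" for E F
  proof -
    have gE: "nondegenerate_continuum (g ` E)" "g ` E \<subseteq> \<Omega>" "f ` g ` E = E"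
      using nondegenerate_image[OF gh E] homeomorphism_image_image[OF gh E(2)] E(2) gh
      by (auto simp: homeomorphism_def)
    have gF: "nondegenerate_continuum (g ` F)" "g ` F \<subseteq> \<Omega>" "f ` g ` F = F"
      using nondegenerate_image[OF gh F] homeomorphism_image_image[OF gh F(2)] F(2) gh
      by (auto simp: homeomorphism_def)
    \<comment> \<open>The estimate for \<open>f\<close> is applied to the images under
      \<open>g\<close> in exchanged order, which is exactly membership of their ratio in
      \<open>S\<close>.\<close>
    have "g ` F \<inter> g ` E \<noteq> {}" using EF by blast
    then have "diameter F / diameter E \<le> \<eta> (diameter (g ` F) / diameter (g ` E))"
      using \<eta>(4)[OF gF(1,2) gE(1,2)] gE(3) gF(3) by simp
    then have "diameter (g ` E) / diameter (g ` F) \<in> S (diameter E / diameter F)"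
      using gE(1) gF(1) by (simp add: S_def nondegenerate_diameter_pos)
    moreover have t: "0 < diameter E / diameter F" using E F by (simp add: nondegenerate_diameter_pos)
    ultimately show ?thesis
      using cSup_upper[OF _ bdd[OF t]] unfolding \<theta>_def by fastforce
  qed
  then show ?thesis
    unfolding BQS_homeomorphism_def using gh pos mono lim
    by (intro conjI exI[of _ f] exI[of _ \<theta>]) simp_all
qed

section \<open>Absolute bounds from relative distortion\<close>

locale BQS_domains = source: proper_domain \<Omega> + target: proper_domain \<Omega>'
  for \<Omega> :: "'a::metric_space set" and \<Omega>' :: "'b::metric_space set" +
  fixes f :: "'a \<Rightarrow> 'b" and g :: "'b \<Rightarrow> 'a"
  assumes homeo: "homeomorphism \<Omega> \<Omega>' f g" and BQS: "BQS_homeomorphism \<Omega> \<Omega>' f"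
    and nontrivial: "\<exists>x\<in>\<Omega>. \<exists>y\<in>\<Omega>. x \<noteq> y"
begin

lemma f_in: "x \<in> \<Omega> \<Longrightarrow> f x \<in> \<Omega>'" and g_in: "y \<in> \<Omega>' \<Longrightarrow> g y \<in> \<Omega>"
  and gf: "x \<in> \<Omega> \<Longrightarrow> g (f x) = x" and fg: "y \<in> \<Omega>' \<Longrightarrow> f (g y) = y"
  and f_onto: "f ` \<Omega> = \<Omega>'" and cont_f: "continuous_on \<Omega> f" and cont_g: "continuous_on \<Omega>' g"
  using homeo by (auto simp: homeomorphism_def)

text \<open>The locale is symmetric in the two domains, so each fact about \<open>f\<close> is also
  available for \<open>g\<close>.\<close>

lemma swap: "BQS_domains \<Omega>' \<Omega> g f"
proof (unfold_locales)
  show "homeomorphism \<Omega>' \<Omega> g f" using homeo by (rule homeomorphism_symD)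
  show "BQS_homeomorphism \<Omega>' \<Omega> g" using BQS_homeomorphism_inverse[OF homeo BQS] .
  show "\<exists>x\<in>\<Omega>'. \<exists>y\<in>\<Omega>'. x \<noteq> y" using nontrivial f_in gf by metis
qed

lemma image_f_subset: "E \<subseteq> \<Omega> \<Longrightarrow> f ` E \<subseteq> \<Omega>'" using f_in by blast

lemma g_image_f: "E \<subseteq> \<Omega> \<Longrightarrow> g ` f ` E = E" using homeomorphism_image_image[OF homeo] .

lemma inj_f: "inj_on f \<Omega>" using gf by (metis inj_onI)

lemma continuum_f: "continuum C \<Longrightarrow> C \<subseteq> \<Omega> \<Longrightarrow> continuum (f ` C)"
  using continuum_image[OF cont_f] .

lemma distortion:
  obtains \<eta> :: "real \<Rightarrow> real" where "\<And>t. t > 0 \<Longrightarrow> \<eta> t > 0"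
    "\<And>s t. 0 < s \<Longrightarrow> s \<le> t \<Longrightarrow> \<eta> s \<le> \<eta> t"
    "\<And>E F. nondegenerate_continuum E \<Longrightarrow> E \<subseteq> \<Omega> \<Longrightarrow> nondegenerate_continuum F \<Longrightarrow> F \<subseteq> \<Omega> \<Longrightarrow>
       E \<inter> F \<noteq> {} \<Longrightarrow> diameter (f ` E) \<le> \<eta> (diameter E / diameter F) * diameter (f ` F)"
proof -
  obtain \<eta> :: "real \<Rightarrow> real" where \<eta>: "\<And>t. t > 0 \<Longrightarrow> \<eta> t > 0" "mono_on {0<..} \<eta>"
    "\<And>E F. nondegenerate_continuum E \<Longrightarrow> E \<subseteq> \<Omega> \<Longrightarrow> nondegenerate_continuum F \<Longrightarrow> F \<subseteq> \<Omega> \<Longrightarrow>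
       E \<inter> F \<noteq> {} \<Longrightarrow> diameter (f ` E) / diameter (f ` F) \<le> \<eta> (diameter E / diameter F)"
    using BQS_homeomorphismE[OF BQS] by metis
  show thesis
  proof (rule that[of \<eta>])
    show "\<eta> s \<le> \<eta> t" if "0 < s" "s \<le> t" for s t using that by (intro mono_onD[OF \<eta>(2)]) auto
    fix E F assume EF: "nondegenerate_continuum E" "E \<subseteq> \<Omega>" "nondegenerate_continuum F" "F \<subseteq> \<Omega>" "E \<inter> F \<noteq> {}"
    then have "0 < diameter (f ` F)"
      using nondegenerate_image[OF homeo] nondegenerate_diameter_pos by blast
    then show "diameter (f ` E) \<le> \<eta> (diameter E / diameter F) * diameter (f ` F)"
      using \<eta>(3)[OF EF] by (simp add: field_simps)
  qed (use \<eta>(1) in auto)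
qed

text \<open>The distortion condition concerns nondegenerate continua only; this supplies one as a
  standard of comparison.\<close>

lemma nondegenerate_continuum_at:
  assumes "q \<in> \<Omega>" shows "\<exists>F. nondegenerate_continuum F \<and> F \<subseteq> \<Omega> \<and> q \<in> F"
proof -
  obtain y where "y \<in> \<Omega>" "y \<noteq> q" using nontrivial by metis
  then show ?thesis
    using source.continuum_through[OF assms, of y] unfolding nondegenerate_continuum_def by metis
qed

text \<open>Comparison with the fixed continuum \<open>F\<close> turns the quasisymmetry condition, which only relates
  intersecting continua, into absolute bounds.\<close>

lemma mbounded_anchor:
  assumes "Q \<subseteq> \<Omega>" "mbounded \<Omega> Q"
  obtains F D where "nondegenerate_continuum F" "F \<subseteq> \<Omega>" "0 \<le> D"
    "\<And>x. x \<in> Q \<Longrightarrow> \<exists>K. nondegenerate_continuum K \<and> K \<subseteq> \<Omega> \<and> F \<subseteq> K \<and> x \<in> K \<and> diameter K \<le> D"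
proof (cases "Q = {}")
  case True
  obtain q where "q \<in> \<Omega>" using nontrivial by blast
  then obtain F where "nondegenerate_continuum F" "F \<subseteq> \<Omega>" using nondegenerate_continuum_at by blast
  then show ?thesis using that[of F 0] True by blast
next
  case False
  then obtain q where q: "q \<in> Q" by blast
  obtain D where
    D: "\<forall>x\<in>Q. \<forall>y\<in>Q. \<exists>P. continuum P \<and> P \<subseteq> \<Omega> \<and> x \<in> P \<and> y \<in> P \<and> diameter P \<le> D"
    using assms unfolding mbounded_def by blast
  obtain F where F: "nondegenerate_continuum F" "F \<subseteq> \<Omega>" "q \<in> F"
    using nondegenerate_continuum_at q assms(1) by blast
  have "\<exists>K. nondegenerate_continuum K \<and> K \<subseteq> \<Omega> \<and> F \<subseteq> K \<and> x \<in> K \<and> diameter K \<le> diameter F + \<bar>D\<bar>"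
    if x: "x \<in> Q" for x
  proof -
    obtain P where P: "continuum P" "P \<subseteq> \<Omega>" "q \<in> P" "x \<in> P" "diameter P \<le> D" using D q x by blast
    then have ne: "F \<inter> P \<noteq> {}" using F by blast
    then have "diameter (F \<union> P) \<le> diameter F + \<bar>D\<bar>"
      using diameter_continuum_Un[of F P] P F by (simp add: nondegenerate_continuum_def)
    then show ?thesis
      using nondegenerate_continuum_Un[OF F(1) P(1) ne] P F by (intro exI[of _ "F \<union> P"]) auto
  qed
  then show ?thesis
    using that[of F "diameter F + \<bar>D\<bar>"] F nondegenerate_diameter_pos[OF F(1)] by simp
qed

text \<open>Any two points of \<open>Q\<close> are joined through the anchor \<open>F\<close> by a
  continuum of diameter at most \<open>2 * D\<close>. Distortion against \<open>F\<close> bounds the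
  diameter of its image by one constant.\<close>

lemma mbounded_image:
  assumes "Q \<subseteq> \<Omega>" "mbounded \<Omega> Q" shows "mbounded \<Omega>' (f ` Q)"
proof -
  obtain F D where F: "nondegenerate_continuum F" "F \<subseteq> \<Omega>" and
    D: "\<And>x. x \<in> Q \<Longrightarrow> \<exists>K. nondegenerate_continuum K \<and> K \<subseteq> \<Omega> \<and> F \<subseteq> K \<and> x \<in> K \<and> diameter K \<le> D"
    using mbounded_anchor[OF assms] by metis
  obtain \<eta> :: "real \<Rightarrow> real" where \<eta>:
    "\<And>s t. 0 < s \<Longrightarrow> s \<le> t \<Longrightarrow> \<eta> s \<le> \<eta> t"
    "\<And>E F. nondegenerate_continuum E \<Longrightarrow> E \<subseteq> \<Omega> \<Longrightarrow> nondegenerate_continuum F \<Longrightarrow> F \<subseteq> \<Omega> \<Longrightarrow>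
       E \<inter> F \<noteq> {} \<Longrightarrow> diameter (f ` E) \<le> \<eta> (diameter E / diameter F) * diameter (f ` F)"
    using distortion by metis
  obtain z where z: "z \<in> F" using F(1) by (auto simp: nondegenerate_continuum_def)
  have Fpos: "0 < diameter F" "0 < diameter (f ` F)"
    using nondegenerate_diameter_pos F nondegenerate_image[OF homeo F] by auto
  show ?thesis unfolding mbounded_def
  proof (intro exI[of _ "\<eta> (2 * D / diameter F) * diameter (f ` F)"] ballI)
    fix x' y' assume "x' \<in> f ` Q" "y' \<in> f ` Q"
    then obtain x y where xy: "x \<in> Q" "y \<in> Q" "x' = f x" "y' = f y" by blast
    obtain K L where K: "nondegenerate_continuum K" "K \<subseteq> \<Omega>" "F \<subseteq> K" "x \<in> K" "diameter K \<le> D"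
      and L: "nondegenerate_continuum L" "L \<subseteq> \<Omega>" "F \<subseteq> L" "y \<in> L" "diameter L \<le> D"
      using D xy by metis
    have KL: "K \<inter> L \<noteq> {}" using K L z by blast
    have cKL: "continuum K" "continuum L" using K L by (auto simp: nondegenerate_continuum_def)
    have nd: "nondegenerate_continuum (K \<union> L)" using nondegenerate_continuum_Un[OF K(1) cKL(2) KL] .
    have "diameter (K \<union> L) \<le> 2 * D" using diameter_continuum_Un[OF cKL KL] K L by simp
    then have "\<eta> (diameter (K \<union> L) / diameter F) \<le> \<eta> (2 * D / diameter F)"
      using nondegenerate_diameter_pos[OF nd] Fpos by (intro \<eta>(1)) (auto simp: divide_right_mono)
    moreover have "diameter (f ` (K \<union> L)) \<le> \<eta> (diameter (K \<union> L) / diameter F) * diameter (f ` F)"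
      using K L F z by (intro \<eta>(2)[OF nd _ F]) auto
    ultimately have "diameter (f ` (K \<union> L)) \<le> \<eta> (2 * D / diameter F) * diameter (f ` F)"
      using Fpos by (meson mult_right_mono order.trans less_imp_le)
    moreover have "continuum (f ` (K \<union> L))" "f ` (K \<union> L) \<subseteq> \<Omega>'"
      using continuum_f[OF continuum_Un[OF cKL KL]] image_f_subset K L by blast+
    moreover have "x' \<in> f ` (K \<union> L)" "y' \<in> f ` (K \<union> L)" using xy K L by auto
    ultimately show "\<exists>P. continuum P \<and> P \<subseteq> \<Omega>' \<and> x' \<in> P \<and> y' \<in> P \<and>
      diameter P \<le> \<eta> (2 * D / diameter F) * diameter (f ` F)" by blast
  qed
qed

text \<open>A continuum \<open>K\<close> links \<open>C\<close> to the anchor \<open>F\<close>.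
  Distortion bounds the image of \<open>K\<close> by a multiple of the image of \<open>C\<close>,
  while the image of \<open>K\<close> contains that of \<open>F\<close>. Meeting \<open>Q\<close> is
  what bounds \<open>K\<close>, and with it the multiple.\<close>

lemma diameter_image_lower:
  assumes "Q \<subseteq> \<Omega>" "mbounded \<Omega> Q" "0 < \<delta>"
  shows "\<exists>\<epsilon>>0. \<forall>C. continuum C \<and> C \<subseteq> \<Omega> \<and> C \<inter> Q \<noteq> {} \<and> \<delta> \<le> diameter C \<longrightarrow> \<epsilon> \<le> diameter (f ` C)"
proof -
  obtain F D where F: "nondegenerate_continuum F" "F \<subseteq> \<Omega>" and D0: "0 \<le> D" and
    D: "\<And>x. x \<in> Q \<Longrightarrow> \<exists>K. nondegenerate_continuum K \<and> K \<subseteq> \<Omega> \<and> F \<subseteq> K \<and> x \<in> K \<and> diameter K \<le> D"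
    using mbounded_anchor[OF assms(1,2)] by metis
  obtain \<eta> :: "real \<Rightarrow> real" where \<eta>: "\<And>t. t > 0 \<Longrightarrow> \<eta> t > 0"
    "\<And>s t. 0 < s \<Longrightarrow> s \<le> t \<Longrightarrow> \<eta> s \<le> \<eta> t"
    "\<And>E F. nondegenerate_continuum E \<Longrightarrow> E \<subseteq> \<Omega> \<Longrightarrow> nondegenerate_continuum F \<Longrightarrow> F \<subseteq> \<Omega> \<Longrightarrow>
       E \<inter> F \<noteq> {} \<Longrightarrow> diameter (f ` E) \<le> \<eta> (diameter E / diameter F) * diameter (f ` F)"
    using distortion by metis
  \<comment> \<open>\<open>D + 1\<close> instead of \<open>D\<close> makes the argument of
    \<open>\<eta>\<close> positive even for \<open>D = 0\<close>.\<close>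
  define c where "c = \<eta> ((D + 1) / \<delta>)"
  have c: "0 < c" using \<eta>(1) D0 assms(3) by (simp add: c_def)
  have Fpos: "0 < diameter (f ` F)"
    using nondegenerate_diameter_pos nondegenerate_image[OF homeo F] by auto
  show ?thesis
  proof (intro exI[of _ "diameter (f ` F) / c"] conjI allI impI)
    show "0 < diameter (f ` F) / c" using Fpos c by simp
    fix C assume C: "continuum C \<and> C \<subseteq> \<Omega> \<and> C \<inter> Q \<noteq> {} \<and> \<delta> \<le> diameter C"
    then obtain x where x: "x \<in> C" "x \<in> Q" by blast
    have nC: "nondegenerate_continuum C" using C assms(3) by (intro nondegenerateI) auto
    obtain K where K: "nondegenerate_continuum K" "K \<subseteq> \<Omega>" "F \<subseteq> K" "x \<in> K" "diameter K \<le> D"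
      using D x by blast
    have "diameter K / diameter C \<le> (D + 1) / \<delta>"
      using K C assms(3) nondegenerate_diameter_pos[OF K(1)] by (intro frac_le) auto
    then have "\<eta> (diameter K / diameter C) \<le> c"
      unfolding c_def using nondegenerate_diameter_pos[OF K(1)] nondegenerate_diameter_pos[OF nC]
      by (intro \<eta>(2)) auto
    moreover have "diameter (f ` K) \<le> \<eta> (diameter K / diameter C) * diameter (f ` C)"
      using \<eta>(3)[OF K(1,2) nC] C x K by blast
    moreover have "0 \<le> diameter (f ` C)"
      using C continuum_f continuum_bounded diameter_ge_0 by blast
    ultimately have "diameter (f ` K) \<le> c * diameter (f ` C)"
      by (meson mult_right_mono order.trans)
    moreover have "continuum (f ` K)" using K continuum_f by (auto simp: nondegenerate_continuum_def)
    then have "diameter (f ` F) \<le> diameter (f ` K)"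
      using K(3) continuum_bounded by (intro diameter_subset) auto
    ultimately show "diameter (f ` F) / c \<le> diameter (f ` C)"
      using c by (simp add: field_simps)
  qed
qed

end

section \<open>Images of chains\<close>

lemma image_closure_subset:
  fixes f :: "'a::metric_space \<Rightarrow> 'b::metric_space"
  assumes "continuous_on \<Omega> f" "E \<subseteq> \<Omega>" "x \<in> \<Omega>" "x \<in> closure E"
  shows "f x \<in> closure (f ` E)"
proof -
  obtain u where u: "\<And>n::nat. u n \<in> E" "u \<longlonglongrightarrow> x" using assms(4) closure_sequential by metis
  then have "(f \<circ> u) \<longlonglongrightarrow> f x"
    using assms(1-3) unfolding continuous_on_sequentially by blast
  then show ?thesis unfolding closure_sequential using u(1) by (intro exI[of _ "f \<circ> u"]) auto
qed

text \<open>The relative frontier is expressed through closures of two subsets of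
  \<open>\<Omega>\<close>, whose traces on \<open>\<Omega>\<close> a homeomorphism of domains
  preserves.\<close>

lemma open_Int_frontier:
  assumes "open \<Omega>" shows "\<Omega> \<inter> frontier E = \<Omega> \<inter> closure E \<inter> closure (\<Omega> - E)"
proof -
  have "\<Omega> \<inter> closure (- E) = \<Omega> \<inter> closure (\<Omega> - E)"
    using open_Int_closure_subset[OF assms, of "- E"] closure_mono[of "\<Omega> - E" "- E"]
    by (auto simp: Diff_eq)
  then show ?thesis by (auto simp: frontier_closures)
qed

definition image_chain :: "('a \<Rightarrow> 'b) \<Rightarrow> (nat \<Rightarrow> 'a set) \<Rightarrow> nat \<Rightarrow> 'b set" where
  "image_chain f E = (\<lambda>k. f ` E k)"

lemma chain_divides_image: "chain_divides E F \<Longrightarrow> chain_divides (image_chain f E) (image_chain f F)"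
  unfolding chain_divides_def image_chain_def by (meson image_mono)

lemma chain_equivalent_image:
  "chain_equivalent E F \<Longrightarrow> chain_equivalent (image_chain f E) (image_chain f F)"
  by (simp add: chain_equivalent_def chain_divides_image)

context BQS_domains begin

section \<open>Relative closures, frontiers and components under the map\<close>

lemma image_closure:
  assumes "E \<subseteq> \<Omega>" shows "\<Omega>' \<inter> closure (f ` E) = f ` (\<Omega> \<inter> closure E)"
proof
  show "f ` (\<Omega> \<inter> closure E) \<subseteq> \<Omega>' \<inter> closure (f ` E)"
    using image_closure_subset[OF cont_f assms] f_in by blast
  show "\<Omega>' \<inter> closure (f ` E) \<subseteq> f ` (\<Omega> \<inter> closure E)"
  proof
    fix y assume y: "y \<in> \<Omega>' \<inter> closure (f ` E)"
    then have "g y \<in> closure (g ` f ` E)"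
      using image_closure_subset[OF cont_g image_f_subset[OF assms]] by blast
    then have "g y \<in> \<Omega> \<inter> closure E" using g_image_f[OF assms] g_in y by auto
    then show "y \<in> f ` (\<Omega> \<inter> closure E)" using fg y by (metis IntD1 imageI)
  qed
qed

lemma image_frontier:
  assumes "E \<subseteq> \<Omega>" shows "\<Omega>' \<inter> frontier (f ` E) = f ` (\<Omega> \<inter> frontier E)"
proof -
  have diff: "\<Omega>' - f ` E = f ` (\<Omega> - E)"
    using inj_on_image_set_diff[OF inj_f _ assms, of \<Omega>] f_onto by simp
  have "\<Omega>' \<inter> frontier (f ` E) = (\<Omega>' \<inter> closure (f ` E)) \<inter> (\<Omega>' \<inter> closure (f ` (\<Omega> - E)))"
    unfolding open_Int_frontier[OF target.open_domain] diff by blast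
  also have "\<dots> = f ` (\<Omega> \<inter> closure E) \<inter> f ` (\<Omega> \<inter> closure (\<Omega> - E))"
    using image_closure[OF assms] image_closure[of "\<Omega> - E"] by simp
  also have "\<dots> = f ` ((\<Omega> \<inter> closure E) \<inter> (\<Omega> \<inter> closure (\<Omega> - E)))"
    using inj_on_image_Int[OF inj_f, of "\<Omega> \<inter> closure E" "\<Omega> \<inter> closure (\<Omega> - E)"] by simp
  also have "(\<Omega> \<inter> closure E) \<inter> (\<Omega> \<inter> closure (\<Omega> - E)) = \<Omega> \<inter> frontier E"
    unfolding open_Int_frontier[OF source.open_domain] by blast
  finally show ?thesis .
qed

lemma image_connected: "connected E \<Longrightarrow> E \<subseteq> \<Omega> \<Longrightarrow> connected (f ` E)"
  by (meson cont_f connected_continuous_image continuous_on_subset)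

lemma image_closedin: "closedin (top_of_set \<Omega>) R \<Longrightarrow> closedin (top_of_set \<Omega>') (f ` R)"
  using homeomorphism_imp_closed_map[OF homeo] .

text \<open>Maximality is tested in \<open>\<Omega>\<close>: a connected set around the image of
  \<open>C\<close> is pulled back by \<open>g\<close> and must stay in \<open>C\<close>.\<close>

lemma image_components:
  assumes "R \<subseteq> \<Omega>" "C \<in> components (\<Omega> - R)" shows "f ` C \<in> components (\<Omega>' - f ` R)"
  unfolding in_components_maximal
proof (intro conjI allI impI)
  have C: "C \<subseteq> \<Omega> - R" "connected C" "C \<noteq> {}"
    using assms(2) by (simp_all add: in_components_maximal)
  have diff: "\<Omega>' - f ` R = f ` (\<Omega> - R)"
    using inj_on_image_set_diff[OF inj_f _ assms(1), of \<Omega>] f_onto by simp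
  show "f ` C \<noteq> {}" "f ` C \<subseteq> \<Omega>' - f ` R" "connected (f ` C)"
    using C image_connected[of C] unfolding diff by auto
  fix D assume D: "D \<noteq> {} \<and> f ` C \<subseteq> D \<and> D \<subseteq> \<Omega>' - f ` R \<and> connected D"
  then have D': "connected D" "D \<subseteq> \<Omega>'" by auto
  have "g ` D \<subseteq> g ` f ` (\<Omega> - R)" using D unfolding diff by blast
  then have gD: "g ` D \<subseteq> \<Omega> - R" using g_image_f[of "\<Omega> - R"] by simp
  have "g ` f ` C \<subseteq> g ` D" using D by blast
  then have "C \<subseteq> g ` D" using g_image_f[of C] C by auto
  then have "g ` D \<subseteq> C"
    using components_maximal[OF assms(2) BQS_domains.image_connected[OF swap D'] gD] C(3) by blast
  then have "f ` g ` D \<subseteq> f ` C" by blast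
  then show "D = f ` C" using D BQS_domains.g_image_f[OF swap D'(2)] by auto
qed

section \<open>Transport of the conditions on chains\<close>

lemma mseparated_image:
  assumes "mseparated \<Omega> A B" "A \<subseteq> \<Omega>" "B \<subseteq> \<Omega>" "Q \<subseteq> \<Omega>" "mbounded \<Omega> Q"
    "\<And>C. continuum C \<Longrightarrow> C \<subseteq> \<Omega> \<Longrightarrow> C \<inter> A \<noteq> {} \<Longrightarrow> C \<inter> B \<noteq> {} \<Longrightarrow> C \<inter> Q \<noteq> {}"
  shows "mseparated \<Omega>' (f ` A) (f ` B)"
proof -
  obtain \<delta> where \<delta>: "\<delta> > 0"
    "\<And>C. continuum C \<Longrightarrow> C \<subseteq> \<Omega> \<Longrightarrow> C \<inter> A \<noteq> {} \<Longrightarrow> C \<inter> B \<noteq> {} \<Longrightarrow> \<delta> \<le> diameter C"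
    using assms(1) unfolding mseparated_def by blast
  obtain \<epsilon> where \<epsilon>: "\<epsilon> > 0"
    "\<And>C. continuum C \<Longrightarrow> C \<subseteq> \<Omega> \<Longrightarrow> C \<inter> Q \<noteq> {} \<Longrightarrow> \<delta> \<le> diameter C \<Longrightarrow> \<epsilon> \<le> diameter (f ` C)"
    using diameter_image_lower[OF assms(4,5) \<delta>(1)] by blast
  show ?thesis unfolding mseparated_def
  proof (intro exI[of _ \<epsilon>] conjI allI impI)
    fix C' assume C': "continuum C' \<and> C' \<subseteq> \<Omega>' \<and> C' \<inter> f ` A \<noteq> {} \<and> C' \<inter> f ` B \<noteq> {}"
    define C where "C = g ` C'"
    have C: "continuum C" "C \<subseteq> \<Omega>" "f ` C = C'"
      using C' BQS_domains.continuum_f[OF swap] g_in BQS_domains.g_image_f[OF swap]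
      by (auto simp: C_def)
    have meets: "C \<inter> S \<noteq> {}" if S: "S \<subseteq> \<Omega>" "C' \<inter> f ` S \<noteq> {}" for S
    proof -
      obtain x where x: "x \<in> S" "f x \<in> C'" using S(2) by blast
      then have "x \<in> C" using gf[of x] S(1) unfolding C_def by (metis image_eqI subsetD)
      then show ?thesis using x(1) by blast
    qed
    have AB: "C \<inter> A \<noteq> {}" "C \<inter> B \<noteq> {}" using meets assms(2,3) C' by simp_all
    show "\<epsilon> \<le> diameter C'"
      using \<epsilon>(2)[OF C(1,2) assms(6)[OF C(1,2) AB] \<delta>(2)[OF C(1,2) AB]] C(3) by simp
  qed (rule \<epsilon>(1))
qed

lemma mchain_image:
  assumes E: "mchain \<Omega> E"
    and "\<And>k. \<exists>Q\<subseteq>\<Omega>. mbounded \<Omega> Q \<and> (\<forall>C. continuum C \<and> C \<subseteq> \<Omega> \<and>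
      C \<inter> (\<Omega> \<inter> frontier (E k)) \<noteq> {} \<and> C \<inter> (\<Omega> \<inter> frontier (E (Suc k))) \<noteq> {} \<longrightarrow> C \<inter> Q \<noteq> {})"
  shows "mchain \<Omega>' (image_chain f E)"
proof -
  have anti: "antimono E" and con: "connected (E k)" and ne: "E k \<noteq> {}" and sub: "E k \<subseteq> \<Omega>"
    and sep: "mseparated \<Omega> (\<Omega> \<inter> frontier (E k)) (\<Omega> \<inter> frontier (E (Suc k)))"
    and imp: "\<Omega> \<inter> (\<Inter>k. closure (E k)) = {}" for k
    using E by (auto simp: mchain_def)
  have "mseparated \<Omega>' (\<Omega>' \<inter> frontier (f ` E k)) (\<Omega>' \<inter> frontier (f ` E (Suc k)))" for k
  proof -
    obtain Q where Q: "Q \<subseteq> \<Omega>" "mbounded \<Omega> Q" "\<And>C. continuum C \<Longrightarrow> C \<subseteq> \<Omega> \<Longrightarrow>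
      C \<inter> (\<Omega> \<inter> frontier (E k)) \<noteq> {} \<Longrightarrow> C \<inter> (\<Omega> \<inter> frontier (E (Suc k))) \<noteq> {} \<Longrightarrow> C \<inter> Q \<noteq> {}"
      using assms(2)[of k] by metis
    show ?thesis
      unfolding image_frontier[OF sub] by (rule mseparated_image[OF sep _ _ Q]) auto
  qed
  moreover have "\<Omega>' \<inter> (\<Inter>k. closure (f ` E k)) = {}"
  proof -
    have "g y \<in> \<Omega> \<inter> (\<Inter>k. closure (E k))" if y: "y \<in> \<Omega>'" "y \<in> (\<Inter>k. closure (f ` E k))" for y
    proof -
      have "y \<in> f ` (\<Omega> \<inter> closure (E k))" for k
        unfolding image_closure[OF sub, symmetric] using y by simp
      then have "g y \<in> closure (E k)" for k
      proof -
        obtain x where "x \<in> \<Omega>" "x \<in> closure (E k)" "y = f x"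
          using \<open>y \<in> f ` (\<Omega> \<inter> closure (E k))\<close> by blast
        then show ?thesis using gf by simp
      qed
      then show ?thesis using g_in[OF y(1)] by simp
    qed
    then show ?thesis using imp by blast
  qed
  moreover have "antimono (image_chain f E)"
    using anti by (simp add: antimono_def image_chain_def image_mono)
  ultimately show ?thesis
    unfolding mchain_def using con ne sub image_connected image_f_subset by (simp add: image_chain_def)
qed

lemma crosscut_image:
  assumes "crosscut \<Omega> A B" shows "crosscut \<Omega>' (f ` A) (f ` B)"
proof -
  obtain R C1 C2 where R: "R \<subseteq> \<Omega>" "closedin (top_of_set \<Omega>) R" "mbounded \<Omega> R"
    "C1 \<in> components (\<Omega> - R)" "C2 \<in> components (\<Omega> - R)" "C1 \<noteq> C2" "A \<subseteq> C1" "B \<subseteq> C2"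
    using assms unfolding crosscut_def by metis
  have "C1 \<subseteq> \<Omega>" "C2 \<subseteq> \<Omega>" using R(4,5) in_components_subset by blast+
  then have "f ` C1 \<noteq> f ` C2" using R(6) inj_on_image_eq_iff[OF inj_f] by blast
  then show ?thesis
    using R image_f_subset image_closedin mbounded_image image_components
    by (intro crosscutI[of "f ` R" _ "f ` C1" "f ` C2"]) auto
qed

text \<open>A continuum missing \<open>R\<close> lies in one component and cannot meet both
  \<open>A\<close> and \<open>B\<close>. The separator itself is therefore the bounded set that
  \<open>mchain_image\<close> asks for.\<close>

lemma crosscut_separates:
  assumes "crosscut \<Omega> A B"
  shows "\<exists>Q\<subseteq>\<Omega>. mbounded \<Omega> Q \<and>
    (\<forall>C. continuum C \<and> C \<subseteq> \<Omega> \<and> C \<inter> A \<noteq> {} \<and> C \<inter> B \<noteq> {} \<longrightarrow> C \<inter> Q \<noteq> {})"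
proof -
  obtain R C1 C2 where R: "R \<subseteq> \<Omega>" "closedin (top_of_set \<Omega>) R" "mbounded \<Omega> R"
    "C1 \<in> components (\<Omega> - R)" "C2 \<in> components (\<Omega> - R)" "C1 \<noteq> C2" "A \<subseteq> C1" "B \<subseteq> C2"
    using assms unfolding crosscut_def by metis
  have dis: "C1 \<inter> C2 = {}" using components_nonoverlap R(4-6) by blast
  have "C \<inter> R \<noteq> {}" if C: "continuum C" "C \<subseteq> \<Omega>" "C \<inter> A \<noteq> {}" "C \<inter> B \<noteq> {}" for C
  proof
    assume "C \<inter> R = {}"
    then have "C \<subseteq> C1" using components_maximal[OF R(4), of C] C R(7) by (auto simp: continuum_def)
    then show False using C(4) R(8) dis by blast
  qed
  then show ?thesis using R(1,3) by blast
qed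

lemma bounded_image:
  assumes "connected E" "E \<subseteq> \<Omega>" "bounded E" shows "bounded (f ` E)"
  using mbounded_imp_bounded mbounded_image[OF assms(2) source.mbounded_connected[OF assms]] by blast

lemma bounded_image_iff:
  assumes "connected E" "E \<subseteq> \<Omega>" shows "bounded (f ` E) \<longleftrightarrow> bounded E"
  using bounded_image[OF assms] g_image_f[OF assms(2)]
    BQS_domains.bounded_image[OF swap image_connected[OF assms] image_f_subset[OF assms(2)]] by auto

lemma mchain_finite_image:
  assumes "mchain_finite \<Omega> E" shows "mchain_finite \<Omega>' (image_chain f E)"
proof -
  have m: "mchain \<Omega> E"
    and alt: "bounded (E k) \<or> crosscut \<Omega> (\<Omega> \<inter> frontier (E k)) (\<Omega> \<inter> frontier (E (Suc k)))" for k
    using assms by (auto simp: mchain_finite_def)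
  have con: "connected (E k)" and sub: "E k \<subseteq> \<Omega>" for k using m by (auto simp: mchain_def)
  have "mchain \<Omega>' (image_chain f E)"
  proof (rule mchain_image[OF m])
    fix k
    show "\<exists>Q\<subseteq>\<Omega>. mbounded \<Omega> Q \<and> (\<forall>C. continuum C \<and> C \<subseteq> \<Omega> \<and>
      C \<inter> (\<Omega> \<inter> frontier (E k)) \<noteq> {} \<and> C \<inter> (\<Omega> \<inter> frontier (E (Suc k))) \<noteq> {} \<longrightarrow> C \<inter> Q \<noteq> {})"
    proof (cases "bounded (E k)")
      case True
      \<comment> \<open>Without a separator the frontier of the bounded member plays its part: every
        joining continuum meets it by definition.\<close>
      have "mbounded \<Omega> (\<Omega> \<inter> frontier (E k))"
        by (rule mbounded_subset[OF source.mbounded_closure[OF con sub True]]) (auto simp: frontier_def)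
      then show ?thesis by (intro exI[of _ "\<Omega> \<inter> frontier (E k)"]) auto
    next
      case False
      then show ?thesis using crosscut_separates alt by blast
    qed
  qed
  moreover have "bounded (f ` E k) \<or>
    crosscut \<Omega>' (\<Omega>' \<inter> frontier (f ` E k)) (\<Omega>' \<inter> frontier (f ` E (Suc k)))" for k
    using alt[of k] bounded_image[OF con sub] crosscut_image unfolding image_frontier[OF sub] by blast
  ultimately show ?thesis by (simp add: mchain_finite_def image_chain_def)
qed

lemma mchain_infinite_image:
  assumes "mchain_infinite \<Omega> E" shows "mchain_infinite \<Omega>' (image_chain f E)"
proof -
  have m: "mchain \<Omega> E" and unb: "\<not> bounded (E k)"
    and R: "\<exists>R\<subseteq>\<Omega>. closedin (top_of_set \<Omega>) R \<and> mbounded \<Omega> R \<and> E k \<in> components (\<Omega> - R)"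
    and esc: "Q \<subseteq> \<Omega> \<Longrightarrow> mbounded \<Omega> Q \<Longrightarrow> \<exists>k. E k \<inter> Q = {}" for k Q
    using assms unfolding mchain_infinite_def by simp_all
  have con: "connected (E k)" and sub: "E k \<subseteq> \<Omega>" for k using m by (auto simp: mchain_def)
  have "mchain \<Omega>' (image_chain f E)"
  proof (rule mchain_image[OF m])
    fix k
    obtain S where "S \<subseteq> \<Omega>" "closedin (top_of_set \<Omega>) S" "mbounded \<Omega> S" "E k \<in> components (\<Omega> - S)"
      using R[of k] by blast
    \<comment> \<open>The frontier of a component lies in its separator, so a continuum meeting the
      frontier meets \<open>S\<close>.\<close>
    moreover from this have "\<Omega> \<inter> frontier (E k) \<subseteq> S" by (intro source.frontier_cross)
    ultimately show "\<exists>Q\<subseteq>\<Omega>. mbounded \<Omega> Q \<and> (\<forall>C. continuum C \<and> C \<subseteq> \<Omega> \<and>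
      C \<inter> (\<Omega> \<inter> frontier (E k)) \<noteq> {} \<and> C \<inter> (\<Omega> \<inter> frontier (E (Suc k))) \<noteq> {} \<longrightarrow> C \<inter> Q \<noteq> {})"
      by (intro exI[of _ S]) blast
  qed
  moreover have "\<not> bounded (f ` E k)" for k using unb bounded_image_iff[OF con sub] by blast
  moreover have "\<exists>R\<subseteq>\<Omega>'. closedin (top_of_set \<Omega>') R \<and> mbounded \<Omega>' R \<and> f ` E k \<in> components (\<Omega>' - R)" for k
  proof -
    obtain S where "S \<subseteq> \<Omega>" "closedin (top_of_set \<Omega>) S" "mbounded \<Omega> S" "E k \<in> components (\<Omega> - S)"
      using R[of k] by blast
    then show ?thesis
      using image_f_subset[of S] image_closedin[of S] mbounded_image[of S] image_components[of S "E k"]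
      by (intro exI[of _ "f ` S"]) simp
  qed
  moreover have "\<exists>k. f ` E k \<inter> Q = {}" if Q: "Q \<subseteq> \<Omega>'" "mbounded \<Omega>' Q" for Q
  proof -
    obtain k where k: "E k \<inter> g ` Q = {}"
      using esc[of "g ` Q"] BQS_domains.mbounded_image[OF swap Q] BQS_domains.image_f_subset[OF swap Q(1)] by blast
    have "f ` E k \<inter> Q = {}"
    proof (rule ccontr)
      assume "f ` E k \<inter> Q \<noteq> {}"
      then obtain x where "x \<in> E k" "f x \<in> Q" by blast
      then have "x \<in> g ` Q" using gf sub by (metis image_eqI subsetD)
      then show False using k \<open>x \<in> E k\<close> by blast
    qed
    then show ?thesis by blast
  qed
  ultimately show ?thesis unfolding mchain_infinite_def image_chain_def by simp
qed

lemma end_chain_image: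
  assumes "E \<in> all_end_chains \<Omega>"
  shows "\<exists>G\<in>all_end_chains \<Omega>'. chain_equivalent G (image_chain f E)"
proof (rule target.equivalent_end_chain)
  show "mchain_finite \<Omega>' (image_chain f E) \<or> mchain_infinite \<Omega>' (image_chain f E)"
    using assms mchain_finite_image mchain_infinite_image source.end_chain_imp_mchain_finite
      source.end_chain_at_infinity_imp_mchain_infinite by (auto simp: all_end_chains_def)
qed

end

section \<open>Prime ends\<close>

lemma ends_eq:
  assumes "\<E> \<in> ends \<Omega>" "E \<in> \<E>"
  shows "\<E> = {F \<in> all_end_chains \<Omega>. chain_equivalent F E}" "E \<in> all_end_chains \<Omega>"
proof -
  obtain A where A: "A \<in> all_end_chains \<Omega>" "\<E> = chain_equiv \<Omega> `` {A}"
    using assms(1) unfolding ends_def by (rule quotientE)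
  have E: "E \<in> all_end_chains \<Omega>" "chain_equivalent A E"
    using assms(2) A by (auto simp: chain_equiv_def chain_equivalent_def)
  have "F \<in> \<E> \<longleftrightarrow> F \<in> all_end_chains \<Omega> \<and> chain_equivalent F A" for F
    using A by (auto simp: chain_equiv_def chain_equivalent_def)
  moreover have "chain_equivalent F A \<longleftrightarrow> chain_equivalent F E" for F
    using E(2) chain_equivalent_trans chain_equivalent_sym by blast
  ultimately show "\<E> = {F \<in> all_end_chains \<Omega>. chain_equivalent F E}" by blast
  show "E \<in> all_end_chains \<Omega>" by (rule E(1))
qed

lemma class_in_ends:
  assumes "E \<in> all_end_chains \<Omega>"
  shows "{F \<in> all_end_chains \<Omega>. chain_equivalent F E} \<in> ends \<Omega>"
proof -
  have "{F \<in> all_end_chains \<Omega>. chain_equivalent F E} = chain_equiv \<Omega> `` {E}"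
    using assms by (auto simp: chain_equiv_def chain_equivalent_def)
  then show ?thesis unfolding ends_def using quotientI[OF assms] by metis
qed

lemma ends_nonempty: "\<E> \<in> ends \<Omega> \<Longrightarrow> \<E> \<noteq> {}"
  unfolding ends_def using in_quotient_imp_non_empty[OF equiv_chain_equiv] .

lemma prime_ends_subset: "prime_ends \<Omega> \<subseteq> ends \<Omega>"
  by (auto simp: prime_ends_def)

text \<open>All genuine chains equivalent to an image chain are collected, so no replacement has to
  be chosen when the image chain is not itself a chain.\<close>

definition end_image ::
  "'b::metric_space set \<Rightarrow> ('a \<Rightarrow> 'b) \<Rightarrow> (nat \<Rightarrow> 'a set) set \<Rightarrow> (nat \<Rightarrow> 'b set) set" where
  "end_image \<Omega>' f \<E> = {G \<in> all_end_chains \<Omega>'. \<exists>E\<in>\<E>. chain_equivalent G (image_chain f E)}"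

definition prime_end_extension ::
  "'b::metric_space set \<Rightarrow> ('a \<Rightarrow> 'b) \<Rightarrow> 'a prime_end_point \<Rightarrow> 'b prime_end_point" where
  "prime_end_extension \<Omega>' f p = (case p of Inl x \<Rightarrow> Inl (f x) | Inr \<E> \<Rightarrow> Inr (end_image \<Omega>' f \<E>))"

lemma prime_end_extension_simps [simp]:
  "prime_end_extension \<Omega>' f (Inl x) = Inl (f x)"
  "prime_end_extension \<Omega>' f (Inr \<E>) = Inr (end_image \<Omega>' f \<E>)"
  by (simp_all add: prime_end_extension_def)

lemma impression_cong:
  assumes "chain_divides E F" shows "(\<Inter>k. closure (E k)) \<subseteq> (\<Inter>k. closure (F k))"
  using assms unfolding chain_divides_def by (meson INF_mono UNIV_I closure_mono)

lemma end_chain_dom: "E \<in> all_end_chains \<Omega> \<Longrightarrow> E k \<subseteq> \<Omega>" "E \<in> all_end_chains \<Omega> \<Longrightarrow> connected (E k)"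
  by (auto simp: all_end_chains_def end_chain_def end_chain_at_infinity_def acceptable_def
      acceptable_at_infinity_def)

lemma end_chain_antimono: "E \<in> all_end_chains \<Omega> \<Longrightarrow> antimono E"
  by (rule decseq_SucI) (auto simp: all_end_chains_def end_chain_def end_chain_at_infinity_def)

text \<open>Every sphere around a point of the impression meets all sets of an unbounded chain.\<close>

lemma (in proper_domain) singleton_impression_bounded:
  assumes E: "E \<in> all_end_chains \<Omega>" and imp: "(\<Inter>k. closure (E k)) = {x}"
  shows "\<exists>k. bounded (E k)"
proof (rule ccontr)
  assume unb: "\<nexists>k. bounded (E k)"
  note con = end_chain_dom(2)[OF E] and anti = end_chain_antimono[OF E]
  have "sphere x 1 \<inter> (\<Inter>k. closure (E k)) = {}" using imp by auto
  moreover have "compact (sphere x 1)"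
  proof (rule proper_compact[OF proper])
    show "closed (sphere x 1)"
      unfolding sphere_def by (intro closed_Collect_eq continuous_intros)
    show "bounded (sphere x 1)" by (rule bounded_subset[OF bounded_cball[of x 1]]) auto
  qed
  ultimately obtain k where k: "sphere x 1 \<inter> closure (E k) = {}"
    using decreasing_closure_compact[OF _ anti] by blast
  have "x \<in> closure (E k)" using imp by blast
  then obtain y where y: "y \<in> E k" "dist y x < 1" 
    using closure_approachable[of x "E k"] zero_less_one by blast
  have "\<not> E k \<subseteq> cball x 1" using unb bounded_subset[OF bounded_cball, of "E k" x 1] by blast
  then obtain z where z: "z \<in> E k" "1 < dist x z" by (auto simp: not_le subset_iff)
  have "connected (dist x ` E k)"
    by (intro connected_continuous_image con continuous_intros)
  then have "1 \<in> dist x ` E k"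
    using y z connectedD_interval[of "dist x ` E k" "dist x y" "dist x z" 1] by (auto simp: dist_commute)
  then obtain w where "w \<in> E k" "dist x w = 1" by auto
  then show False using k closure_subset[of "E k"] by auto
qed

context BQS_domains begin

text \<open>Images of equivalent chains are equivalent, so the result depends neither on the
  representative \<open>E\<close> nor on the replacement \<open>G\<close> of its image.\<close>

lemma end_image_eq:
  assumes "\<E> \<in> ends \<Omega>" "E \<in> \<E>" "G \<in> all_end_chains \<Omega>'" "chain_equivalent G (image_chain f E)"
  shows "end_image \<Omega>' f \<E> = {H \<in> all_end_chains \<Omega>'. chain_equivalent H G}"
proof -
  have "chain_equivalent H (image_chain f F) \<longleftrightarrow> chain_equivalent H G" if "F \<in> \<E>" for F H
  proof -
    have "chain_equivalent F E" using ends_eq[OF assms(1,2)] that by blast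
    then have "chain_equivalent (image_chain f F) G"
      using chain_equivalent_image assms(4) chain_equivalent_trans chain_equivalent_sym by blast
    then show ?thesis using chain_equivalent_trans chain_equivalent_sym by blast
  qed
  then show ?thesis using assms(2) unfolding end_image_def by blast
qed

lemma end_image_mem:
  assumes "\<E> \<in> ends \<Omega>" "E \<in> \<E>"
  obtains G where "G \<in> end_image \<Omega>' f \<E>" "G \<in> all_end_chains \<Omega>'" "chain_equivalent G (image_chain f E)"
  using end_chain_image[OF ends_eq(2)[OF assms]] assms(2) unfolding end_image_def by blast

lemma end_image_in_ends:
  assumes "\<E> \<in> ends \<Omega>" shows "end_image \<Omega>' f \<E> \<in> ends \<Omega>'"
proof -
  obtain E where E: "E \<in> \<E>" using ends_nonempty[OF assms] by blast
  obtain G where "G \<in> all_end_chains \<Omega>'" "chain_equivalent G (image_chain f E)"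
    using end_image_mem[OF assms E] .
  then show ?thesis using end_image_eq[OF assms E] class_in_ends by metis
qed

lemma image_chain_inverse:
  assumes "E \<in> all_end_chains \<Omega>" shows "image_chain g (image_chain f E) = E"
  using g_image_f[OF end_chain_dom(1)[OF assms]] by (simp add: image_chain_def)

lemma end_image_inverse:
  assumes "\<E> \<in> ends \<Omega>" shows "end_image \<Omega> g (end_image \<Omega>' f \<E>) = \<E>"
proof -
  obtain E where E: "E \<in> \<E>" using ends_nonempty[OF assms] by blast
  obtain G where G: "G \<in> end_image \<Omega>' f \<E>" "chain_equivalent G (image_chain f E)"
    using end_image_mem[OF assms E] .
  have "chain_equivalent E (image_chain g G)"
    using chain_equivalent_image[OF G(2), of g] image_chain_inverse[OF ends_eq(2)[OF assms E]]
      chain_equivalent_sym by metis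
  then have "end_image \<Omega> g (end_image \<Omega>' f \<E>) = {H \<in> all_end_chains \<Omega>. chain_equivalent H E}"
    using BQS_domains.end_image_eq[OF swap end_image_in_ends[OF assms] G(1) ends_eq(2)[OF assms E]] by blast
  then show ?thesis using ends_eq(1)[OF assms E] by simp
qed

lemma end_divides_image:
  assumes "\<E> \<in> ends \<Omega>" "\<F> \<in> ends \<Omega>" "end_divides \<E> \<F>"
  shows "end_divides (end_image \<Omega>' f \<E>) (end_image \<Omega>' f \<F>)"
proof -
  obtain E F where EF: "E \<in> \<E>" "F \<in> \<F>" "chain_divides E F"
    using assms(3) unfolding end_divides_def by blast
  obtain G where G: "G \<in> end_image \<Omega>' f \<E>" "chain_equivalent G (image_chain f E)"
    using end_image_mem[OF assms(1) EF(1)] .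
  obtain H where H: "H \<in> end_image \<Omega>' f \<F>" "chain_equivalent H (image_chain f F)"
    using end_image_mem[OF assms(2) EF(2)] .
  have "chain_divides G H"
    using G(2) H(2) chain_divides_image[OF EF(3), of f] chain_divides_trans
    unfolding chain_equivalent_def by blast
  then show ?thesis using G H unfolding end_divides_def by blast
qed

lemma prime_end_image:
  assumes "\<E> \<in> prime_ends \<Omega>" shows "end_image \<Omega>' f \<E> \<in> prime_ends \<Omega>'"
proof -
  have \<E>: "\<E> \<in> ends \<Omega>" using assms prime_ends_subset by blast
  have "\<F> = end_image \<Omega>' f \<E>" if F: "\<F> \<in> ends \<Omega>'" "end_divides \<F> (end_image \<Omega>' f \<E>)" for \<F>
  proof -
    have "end_divides (end_image \<Omega> g \<F>) \<E>"
      using BQS_domains.end_divides_image[OF swap F(1) end_image_in_ends[OF \<E>] F(2)]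
        end_image_inverse[OF \<E>] by simp
    then have "end_image \<Omega> g \<F> = \<E>"
      using assms BQS_domains.end_image_in_ends[OF swap F(1)] by (simp add: prime_ends_def)
    then show ?thesis using BQS_domains.end_image_inverse[OF swap F(1)] by simp
  qed
  then show ?thesis using end_image_in_ends[OF \<E>] by (simp add: prime_ends_def)
qed

section \<open>The extension as a homeomorphism of prime end closures\<close>

lemma extension_in_closure:
  "p \<in> prime_end_closure \<Omega> \<Longrightarrow> prime_end_extension \<Omega>' f p \<in> prime_end_closure \<Omega>'"
  using f_in prime_end_image by (auto simp: prime_end_closure_def)

lemma extension_inverse:
  "p \<in> prime_end_closure \<Omega> \<Longrightarrow> prime_end_extension \<Omega> g (prime_end_extension \<Omega>' f p) = p"
  using gf end_image_inverse[OF subsetD[OF prime_ends_subset]] by (auto simp: prime_end_closure_def)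

text \<open>Convergence to a prime end is phrased by inclusions, so passing to equivalent chains
  only shifts indices. Continuity of \<open>f\<close> enters directly in the clause for points of
  \<open>\<Omega>\<close>.\<close>

lemma extension_converges:
  assumes "prime_end_converges \<Omega> s l"
  shows "prime_end_converges \<Omega>' (prime_end_extension \<Omega>' f \<circ> s) (prime_end_extension \<Omega>' f l)"
  using assms
proof cases
  case (to_point x N u)
  have "\<forall>\<^sub>F n in sequentially. u n \<in> \<Omega>"
    using to_point(3) unfolding eventually_sequentially by blast
  then have "(\<lambda>n. f (u n)) \<longlonglongrightarrow> f x"
    using continuous_on_tendsto_compose[OF cont_f to_point(4,2)] by blast
  then show ?thesis unfolding to_point(1)
    using prime_end_converges.to_point[of "f x" \<Omega>' N "prime_end_extension \<Omega>' f \<circ> s" "\<lambda>n. f (u n)"]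
      to_point(2,3) f_in by simp
next
  case (points_to_end \<E> E u)
  have \<E>: "\<E> \<in> ends \<Omega>" using points_to_end(2) prime_ends_subset by blast
  obtain G where G: "G \<in> end_image \<Omega>' f \<E>" "chain_equivalent G (image_chain f E)"
    using end_image_mem[OF \<E> points_to_end(3)] .
  have "\<exists>N. \<forall>j\<ge>N. f (u j) \<in> G k" for k
  proof -
    obtain i where i: "f ` E i \<subseteq> G k"
      using G(2) unfolding chain_equivalent_def chain_divides_def image_chain_def by blast
    obtain N where "\<forall>j\<ge>N. u j \<in> E i" using points_to_end(5) by blast
    then show ?thesis using i by blast
  qed
  moreover have "\<forall>j. (prime_end_extension \<Omega>' f \<circ> s) j = Inl (f (u j)) \<and> f (u j) \<in> \<Omega>'"
    using points_to_end(4) f_in by simp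
  ultimately show ?thesis unfolding points_to_end(1) prime_end_extension_simps
    by (intro prime_end_converges.points_to_end[OF prime_end_image[OF points_to_end(2)] G(1),
          of _ "\<lambda>j. f (u j)"]) auto
next
  case (ends_to_end \<E> E \<F> F)
  have \<E>: "\<E> \<in> ends \<Omega>" and \<F>: "\<F> j \<in> ends \<Omega>" for j using ends_to_end(2,4) prime_ends_subset by blast+
  obtain G where G: "G \<in> end_image \<Omega>' f \<E>" "chain_equivalent G (image_chain f E)"
    using end_image_mem[OF \<E> ends_to_end(3)] .
  have "\<exists>H. H \<in> end_image \<Omega>' f (\<F> j) \<and> chain_equivalent H (image_chain f (F j))" for j
    using end_image_mem[OF \<F>, of "F j" j] ends_to_end(4) by metis
  then obtain H where H: "\<And>j. H j \<in> end_image \<Omega>' f (\<F> j)"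
    "\<And>j. chain_equivalent (H j) (image_chain f (F j))" by metis
  have "\<exists>N. \<forall>j\<ge>N. \<exists>m. H j m \<subseteq> G k" for k
  proof -
    obtain i where i: "f ` E i \<subseteq> G k"
      using G(2) unfolding chain_equivalent_def chain_divides_def image_chain_def by blast
    obtain N where N: "\<forall>j\<ge>N. \<exists>m. F j m \<subseteq> E i" using ends_to_end(5) by blast
    have "\<exists>m. H j m \<subseteq> G k" if "j \<ge> N" for j
    proof -
      obtain m where "F j m \<subseteq> E i" using N \<open>j \<ge> N\<close> by blast
      moreover obtain m' where "H j m' \<subseteq> f ` F j m"
        using H(2)[of j] unfolding chain_equivalent_def chain_divides_def image_chain_def by blast
      ultimately show ?thesis using i by blast
    qed
    then show ?thesis by blast
  qed
  moreover have "\<forall>j. (prime_end_extension \<Omega>' f \<circ> s) j = Inr (end_image \<Omega>' f (\<F> j)) \<and>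
      end_image \<Omega>' f (\<F> j) \<in> prime_ends \<Omega>' \<and> H j \<in> end_image \<Omega>' f (\<F> j)"
    using ends_to_end(4) prime_end_image H(1) by simp
  ultimately show ?thesis unfolding ends_to_end(1) prime_end_extension_simps
    by (intro prime_end_converges.ends_to_end[OF prime_end_image[OF ends_to_end(2)] G(1),
          of _ "\<lambda>j. end_image \<Omega>' f (\<F> j)" H]) auto
qed

text \<open>Closed sets are defined by limits of sequences, so preserving convergent sequences is
  enough for continuity.\<close>

lemma continuous_extension:
  "continuous_map (prime_end_topology \<Omega>) (prime_end_topology \<Omega>') (prime_end_extension \<Omega>' f)"
  unfolding continuous_map_closedin topspace_prime_end_topology closedin_prime_end_topology
proof (intro conjI allI impI ballI)
  show "prime_end_extension \<Omega>' f \<in> prime_end_closure \<Omega> \<rightarrow> prime_end_closure \<Omega>'"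
    using extension_in_closure by blast
  fix C assume C: "prime_end_closed \<Omega>' C"
  show "prime_end_closed \<Omega> {p \<in> prime_end_closure \<Omega>. prime_end_extension \<Omega>' f p \<in> C}"
    unfolding prime_end_closed_def
  proof (intro conjI allI impI)
    fix s l
    assume sl: "range s \<subseteq> {p \<in> prime_end_closure \<Omega>. prime_end_extension \<Omega>' f p \<in> C} \<and>
      prime_end_converges \<Omega> s l"
    then have "range (prime_end_extension \<Omega>' f \<circ> s) \<subseteq> C" by auto
    then have "prime_end_extension \<Omega>' f l \<in> C"
      using C extension_converges sl unfolding prime_end_closed_def by blast
    then show "l \<in> {p \<in> prime_end_closure \<Omega>. prime_end_extension \<Omega>' f p \<in> C}"
      using sl prime_end_converges_in_closure[of \<Omega> s l] by simp
  qed blast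
qed

lemma homeomorphic_extension:
  "homeomorphic_map (prime_end_topology \<Omega>) (prime_end_topology \<Omega>') (prime_end_extension \<Omega>' f)"
  unfolding homeomorphic_map_maps homeomorphic_maps_def topspace_prime_end_topology
  using continuous_extension BQS_domains.continuous_extension[OF swap]
    extension_inverse BQS_domains.extension_inverse[OF swap] by blast

section \<open>Types of prime ends and singleton impressions\<close>

lemma bounded_prime_end_image:
  assumes "\<E> \<in> bounded_prime_ends \<Omega>" shows "end_image \<Omega>' f \<E> \<in> bounded_prime_ends \<Omega>'"
proof -
  obtain E k where E: "\<E> \<in> prime_ends \<Omega>" "E \<in> \<E>" "compact (closure (E k))"
    using assms by (auto simp: bounded_prime_ends_def)
  then have \<E>: "\<E> \<in> ends \<Omega>" using prime_ends_subset by blast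
  note chain = ends_eq(2)[OF \<E> E(2)]
  obtain G where G: "G \<in> end_image \<Omega>' f \<E>" "chain_equivalent G (image_chain f E)"
    using end_image_mem[OF \<E> E(2)] .
  have "bounded (f ` E k)"
    using bounded_image[OF end_chain_dom(2)[OF chain] end_chain_dom(1)[OF chain]] E(3) source.compact_closure_iff_bounded by blast
  moreover obtain i where "G i \<subseteq> f ` E k"
    using G(2) unfolding chain_equivalent_def chain_divides_def image_chain_def by blast
  ultimately have "compact (closure (G i))"
    using bounded_subset target.compact_closure_bounded by blast
  then show ?thesis using G(1) prime_end_image[OF E(1)] by (auto simp: bounded_prime_ends_def)
qed

text \<open>Every member of a chain equivalent to the image contains the image of some
  \<open>E i\<close>, which is unbounded. The kind of the chain \<open>G\<close> found in the target
  decides between the two types.\<close>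

lemma unbounded_prime_end_image:
  assumes "\<E> \<in> prime_ends \<Omega>" "\<E> \<in> unbounded_prime_ends \<Omega> \<union> ends_at_infinity \<Omega>"
  shows "end_image \<Omega>' f \<E> \<in> unbounded_prime_ends \<Omega>' \<union> ends_at_infinity \<Omega>'"
proof -
  obtain E where E: "E \<in> \<E>" "\<And>k. \<not> bounded (E k)"
    using assms(2) by (auto simp: unbounded_prime_ends_def ends_at_infinity_def
        end_chain_at_infinity_def acceptable_at_infinity_def)
  have \<E>: "\<E> \<in> ends \<Omega>" using assms(1) prime_ends_subset by blast
  note chain = ends_eq(2)[OF \<E> E(1)]
  obtain G where G: "G \<in> end_image \<Omega>' f \<E>" "G \<in> all_end_chains \<Omega>'" "chain_equivalent G (image_chain f E)"
    using end_image_mem[OF \<E> E(1)] .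
  have unb: "\<not> bounded (G k)" for k
  proof
    assume bd: "bounded (G k)"
    obtain i where "f ` E i \<subseteq> G k"
      using G(3) unfolding chain_equivalent_def chain_divides_def image_chain_def by blast
    then have "bounded (f ` E i)" using bd bounded_subset by blast
    then show False using E(2) bounded_image_iff[OF end_chain_dom(2)[OF chain] end_chain_dom(1)[OF chain]] by blast
  qed
  show ?thesis
  proof (cases "end_chain_at_infinity \<Omega>' G")
    case True
    then show ?thesis using G(1) end_image_in_ends[OF \<E>] by (auto simp: ends_at_infinity_def)
  next
    case False
    then have "end_chain \<Omega>' G" using G(2) by (simp add: all_end_chains_def)
    then have "impression (end_image \<Omega>' f \<E>) \<noteq> {}"
      using impression_eq[OF end_image_in_ends[OF \<E>] G(1)] by (simp add: end_chain_def)
    then show ?thesis using unb G(1) prime_end_image[OF assms(1)] by (auto simp: unbounded_prime_ends_def)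
  qed
qed

text \<open>Two points in the impression of the image would yield continua of diameter at least
  \<open>e\<close> near the image chain whose preimages are as small as desired. The lower bound
  \<open>diameter_image_lower\<close> for \<open>g\<close> forbids this.\<close>

lemma singleton_prime_end_image:
  assumes "\<E> \<in> singleton_prime_ends \<Omega>" shows "end_image \<Omega>' f \<E> \<in> singleton_prime_ends \<Omega>'"
proof -
  obtain x where x: "\<E> \<in> prime_ends \<Omega>" "impression \<E> = {x}"
    using assms by (auto simp: singleton_prime_ends_def)
  then have \<E>: "\<E> \<in> ends \<Omega>" using prime_ends_subset by blast
  then obtain E where E: "E \<in> \<E>" using ends_nonempty by blast
  note chain = ends_eq(2)[OF \<E> E]
  note con = end_chain_dom(2)[OF chain] and sub = end_chain_dom(1)[OF chain]
    and anti = end_chain_antimono[OF chain]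
  have imp: "(\<Inter>k. closure (E k)) = {x}" using impression_eq[OF \<E> E] x(2) by simp
  obtain k0 where k0: "bounded (E k0)" using source.singleton_impression_bounded[OF chain imp] by blast
  obtain G where G: "G \<in> end_image \<Omega>' f \<E>" "G \<in> all_end_chains \<Omega>'" "chain_equivalent G (image_chain f E)"
    using end_image_mem[OF \<E> E] .
  have "impression (end_image \<Omega>' f \<E>) = (\<Inter>k. closure (G k))"
    using impression_eq[OF end_image_in_ends[OF \<E>] G(1)] .
  also have "\<dots> = (\<Inter>k. closure (f ` E k))"
    using impression_cong G(3) unfolding chain_equivalent_def image_chain_def by blast
  finally have imp': "impression (end_image \<Omega>' f \<E>) = (\<Inter>k. closure (f ` E k))" .
  have bd: "bounded (f ` E k0)" using bounded_image[OF con sub k0] .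
  have ne: "(\<Inter>k. closure (f ` E k)) \<noteq> {}"
  proof
    have antif: "antimono (\<lambda>k. f ` E k)" using anti by (simp add: antimono_def image_mono)
    assume "(\<Inter>k. closure (f ` E k)) = {}"
    then obtain j where j: "closure (f ` E k0) \<inter> closure (f ` E j) = {}"
      using decreasing_closure_compact[OF target.compact_closure_bounded[OF bd] antif] by blast
    have "E (max j k0) \<subseteq> E j" "E (max j k0) \<subseteq> E k0" using anti by (auto simp: antimono_def)
    moreover have "E (max j k0) \<noteq> {}" using imp by (metis INT_iff UNIV_I closure_empty empty_iff insertI1)
    ultimately show False using j closure_subset[of "f ` E j"] closure_subset[of "f ` E k0"] by blast
  qed
  have "y = z" if yz: "y \<in> (\<Inter>k. closure (f ` E k))" "z \<in> (\<Inter>k. closure (f ` E k))" for y z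
  proof (rule ccontr)
    assume "y \<noteq> z"
    define e where "e = dist y z / 4"
    have e: "e > 0" using \<open>y \<noteq> z\<close> by (simp add: e_def)
    have "mbounded \<Omega>' (f ` E k0)" using mbounded_image[OF sub source.mbounded_connected[OF con sub k0]] .
    then obtain d where d: "d > 0" "\<And>C. continuum C \<Longrightarrow> C \<subseteq> \<Omega>' \<Longrightarrow> C \<inter> f ` E k0 \<noteq> {} \<Longrightarrow>
        e \<le> diameter C \<Longrightarrow> d \<le> diameter (g ` C)"
      using BQS_domains.diameter_image_lower[OF swap image_f_subset[OF sub] _ e] by metis
    \<comment> \<open>Inside a ball of radius \<open>d / 4\<close> points of a member are joined by
      a continuum of diameter at most \<open>d / 2\<close>, below the bound \<open>d\<close>.
      Compactness of the remainder of \<open>closure (E k0)\<close> puts a tail of the chain into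
      this ball.\<close>
    have "(closure (E k0) - ball x (d / 4)) \<inter> (\<Inter>k. closure (E k)) = {}" using imp d(1) by auto
    moreover have "compact (closure (E k0) - ball x (d / 4))"
      using source.compact_closure_bounded[OF k0] by (simp add: compact_diff)
    ultimately obtain j where "(closure (E k0) - ball x (d / 4)) \<inter> closure (E j) = {}"
      using decreasing_closure_compact[OF _ anti] by blast
    then have j: "E k0 \<inter> E j \<subseteq> ball x (d / 4)" using closure_subset by blast
    define k where "k = max k0 j"
    have Ek: "E k \<subseteq> E k0" "E k \<subseteq> E j" using anti by (auto simp: antimono_def k_def)
    then have kb: "E k \<subseteq> ball x (d / 4)" using j by blast
    have "y \<in> closure (f ` E k)" "z \<in> closure (f ` E k)" using yz by blast+
    then obtain a b where ab: "a \<in> E k" "b \<in> E k" "dist (f a) y < e" "dist (f b) z < e"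
      using e unfolding closure_approachable by blast
    have "4 * e \<le> dist (f a) y + dist (f a) (f b) + dist (f b) z"
      using dist_triangle[of y z "f a"] dist_triangle[of "f a" z "f b"] by (simp add: e_def dist_commute)
    then have far: "e \<le> dist (f a) (f b)" using ab e by linarith
    obtain P where P: "continuum P" "P \<subseteq> \<Omega>" "a \<in> P" "b \<in> P" "diameter P \<le> 2 * (d / 4)"
      using source.continuum_in_ball[OF con sub kb _ ab(1,2)] d(1) by auto
    have "dist (f a) (f b) \<le> diameter (f ` P)"
      using diameter_bounded_bound[OF continuum_bounded[OF continuum_f[OF P(1,2)]]] P by blast
    then have "d \<le> diameter (g ` f ` P)"
      using d(2)[OF continuum_f[OF P(1,2)] image_f_subset[OF P(2)]] far P(3) ab(1) Ek(1) by force
    then show False using g_image_f[OF P(2)] P(5) d(1) by simp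
  qed
  then have "\<exists>y. (\<Inter>k. closure (f ` E k)) = {y}" using ne by blast
  then show ?thesis using imp' prime_end_image[OF x(1)] by (simp add: singleton_prime_ends_def)
qed

end

theorem theorem5p14:
  fixes \<Omega> :: "'a::metric_space set" and \<Omega>' :: "'b::metric_space set" and f :: "'a \<Rightarrow> 'b"
  assumes "proper_set (UNIV :: 'a set)" and "locally path_connected (UNIV :: 'a set)"
    and "proper_set (UNIV :: 'b set)" and "locally path_connected (UNIV :: 'b set)"
    and "metric_domain \<Omega>" and "\<not> bounded \<Omega>"
    and "metric_domain \<Omega>'"
    and "BQS_homeomorphism \<Omega> \<Omega>' f"
  shows "\<exists>f\<^sub>P :: 'a prime_end_point \<Rightarrow> 'b prime_end_point.
           homeomorphic_map (prime_end_topology \<Omega>) (prime_end_topology \<Omega>') f\<^sub>P \<and>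
           (\<forall>x\<in>\<Omega>. f\<^sub>P (Inl x) = Inl (f x)) \<and>
           (\<forall>\<E>\<in>prime_ends \<Omega>.
              (\<E> \<in> bounded_prime_ends \<Omega> \<longrightarrow>
                 f\<^sub>P (Inr \<E>) \<in> Inr ` bounded_prime_ends \<Omega>') \<and>
              (\<E> \<in> unbounded_prime_ends \<Omega> \<union> ends_at_infinity \<Omega> \<longrightarrow>
                 f\<^sub>P (Inr \<E>) \<in> Inr ` (unbounded_prime_ends \<Omega>' \<union> ends_at_infinity \<Omega>')) \<and>
              (\<E> \<in> singleton_prime_ends \<Omega> \<longrightarrow>
                 f\<^sub>P (Inr \<E>) \<in> Inr ` singleton_prime_ends \<Omega>'))"
proof -
  obtain g where g: "homeomorphism \<Omega> \<Omega>' f g"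
    using assms(8) unfolding BQS_homeomorphism_def by (elim conjE exE)
  have "\<exists>x\<in>\<Omega>. \<exists>y\<in>\<Omega>. x \<noteq> y"
  proof (rule ccontr)
    assume "\<not> ?thesis"
    then have "\<exists>a. \<Omega> \<subseteq> {a}" by (metis insertI1 subsetI)
    then show False using assms(6) bounded_subset[of "{_}" \<Omega>] by auto
  qed
  then interpret BQS_domains \<Omega> \<Omega>' f g
    using assms g by unfold_locales
  show ?thesis
    using homeomorphic_extension bounded_prime_end_image unbounded_prime_end_image singleton_prime_end_image
    by (intro exI[of _ "prime_end_extension \<Omega>' f"]) simp
qed

end
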